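(* Let $A\,|\,B\,|\,C$ be a tower of rings. Then $A\,|\,B\,|\,C$ is right depth three if and only if there are a positive integer $N$ and elements $\gamma_1,\dots,\gamma_N\in \operatorname{End}{}_BA_C$ and $u_1,\dots,u_N\in (A\otimes_BA)^C$ such that for all $x,y\in A$, $$x\otimes_B y=\sum_{i=1}^N x\,\gamma_i(y)\,u_i .$$
   Context: Rings are unital. A tower $A\,|\,B\,|\,C$ is a pair of unital ring homomorphisms $C\to B\to A$, with induced bimodule structures. The tower is right depth three if, as $A$-$C$-bimodules, $A\otimes_BA$ is isomorphic to a direct summand of $A^N$ for some positive integer $N$. $\operatorname{End}{}_BA_C$ is the ring of $B$-$C$-bimodule endomorphisms of $A$, and $(A\otimes_BA)^C=\{m\in A\otimes_BA: cm=mc \text{ for all } c\in C\}$. *)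

theory Defs
  imports "HOL-Algebra.Algebra"
begin

text \<open>The \<^const>\<open>monoid.mult\<close> and \<^const>\<open>one\<close> fields inherited from \<^typ>\<open>'m ring\<close> play no role in a
  bimodule, exactly as for the record \<^typ>\<open>('r, 'm) module\<close> in the library.\<close>

record ('r, 'm, 's) bimodule = "('r, 'm) module" +
  rsmult :: "['m, 's] \<Rightarrow> 'm" (infixl \<open>\<triangleleft>\<index>\<close> 70)

text \<open>The library locale \<^locale>\<open>module\<close> requires a commutative ring of scalars, so it cannot be reused
  for the one-sided actions. Rings may be zero.\<close>

locale bimodule = R?: ring R + S?: ring S + M?: abelian_group M
  for R :: "('r, 'x) ring_scheme" and S :: "('s, 'y) ring_scheme"
    and M :: "('r, 'm, 's, 'z) bimodule_scheme" (structure) +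
  assumes lsmult_closed: "\<lbrakk>r \<in> carrier R; x \<in> carrier M\<rbrakk> \<Longrightarrow> r \<odot> x \<in> carrier M"
    and lsmult_l_distr: "\<lbrakk>r \<in> carrier R; r' \<in> carrier R; x \<in> carrier M\<rbrakk>
      \<Longrightarrow> (r \<oplus>\<^bsub>R\<^esub> r') \<odot> x = r \<odot> x \<oplus> r' \<odot> x"
    and lsmult_r_distr: "\<lbrakk>r \<in> carrier R; x \<in> carrier M; y \<in> carrier M\<rbrakk>
      \<Longrightarrow> r \<odot> (x \<oplus> y) = r \<odot> x \<oplus> r \<odot> y"
    and lsmult_assoc: "\<lbrakk>r \<in> carrier R; r' \<in> carrier R; x \<in> carrier M\<rbrakk>
      \<Longrightarrow> (r \<otimes>\<^bsub>R\<^esub> r') \<odot> x = r \<odot> (r' \<odot> x)"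
    and lsmult_one: "x \<in> carrier M \<Longrightarrow> \<one>\<^bsub>R\<^esub> \<odot> x = x"
    and rsmult_closed: "\<lbrakk>x \<in> carrier M; s \<in> carrier S\<rbrakk> \<Longrightarrow> x \<triangleleft> s \<in> carrier M"
    and rsmult_l_distr: "\<lbrakk>x \<in> carrier M; y \<in> carrier M; s \<in> carrier S\<rbrakk>
      \<Longrightarrow> (x \<oplus> y) \<triangleleft> s = x \<triangleleft> s \<oplus> y \<triangleleft> s"
    and rsmult_r_distr: "\<lbrakk>x \<in> carrier M; s \<in> carrier S; s' \<in> carrier S\<rbrakk>
      \<Longrightarrow> x \<triangleleft> (s \<oplus>\<^bsub>S\<^esub> s') = x \<triangleleft> s \<oplus> x \<triangleleft> s'"
    and rsmult_assoc: "\<lbrakk>x \<in> carrier M; s \<in> carrier S; s' \<in> carrier S\<rbrakk>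
      \<Longrightarrow> x \<triangleleft> (s \<otimes>\<^bsub>S\<^esub> s') = (x \<triangleleft> s) \<triangleleft> s'"
    and rsmult_one: "x \<in> carrier M \<Longrightarrow> x \<triangleleft> \<one>\<^bsub>S\<^esub> = x"
    and lsmult_rsmult: "\<lbrakk>r \<in> carrier R; x \<in> carrier M; s \<in> carrier S\<rbrakk>
      \<Longrightarrow> (r \<odot> x) \<triangleleft> s = r \<odot> (x \<triangleleft> s)"

definition bimodule_hom ::
  "[('r, 'x) ring_scheme, ('s, 'y) ring_scheme, ('r, 'm, 's, 'z) bimodule_scheme,
    ('r, 'n, 's, 'w) bimodule_scheme] \<Rightarrow> ('m \<Rightarrow> 'n) set"
  where "bimodule_hom R S M N = {h \<in> carrier M \<rightarrow> carrier N.
    (\<forall>x\<in>carrier M. \<forall>y\<in>carrier M. h (x \<oplus>\<^bsub>M\<^esub> y) = h x \<oplus>\<^bsub>N\<^esub> h y) \<and>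
    (\<forall>r\<in>carrier R. \<forall>x\<in>carrier M. h (r \<odot>\<^bsub>M\<^esub> x) = r \<odot>\<^bsub>N\<^esub> h x) \<and>
    (\<forall>x\<in>carrier M. \<forall>s\<in>carrier S. h (x \<triangleleft>\<^bsub>M\<^esub> s) = h x \<triangleleft>\<^bsub>N\<^esub> s)}"

definition bimodule_iso ::
  "[('r, 'x) ring_scheme, ('s, 'y) ring_scheme, ('r, 'm, 's, 'z) bimodule_scheme,
    ('r, 'n, 's, 'w) bimodule_scheme] \<Rightarrow> ('m \<Rightarrow> 'n) set"
  where "bimodule_iso R S M N = {h \<in> bimodule_hom R S M N. bij_betw h (carrier M) (carrier N)}"

locale subbimodule = submodule P R M
  for P and R :: "('r, 'x) ring_scheme" and S :: "('s, 'y) ring_scheme"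
    and M :: "('r, 'm, 's, 'z) bimodule_scheme" (structure) +
  assumes rsmult_closed: "\<lbrakk>x \<in> P; s \<in> carrier S\<rbrakk> \<Longrightarrow> x \<triangleleft> s \<in> P"

definition direct_summand ::
  "['m set, ('r, 'x) ring_scheme, ('s, 'y) ring_scheme, ('r, 'm, 's, 'z) bimodule_scheme] \<Rightarrow> bool"
  where "direct_summand P R S M \<longleftrightarrow> subbimodule P R S M \<and>
    (\<exists>Q. subbimodule Q R S M \<and> P \<inter> Q = {\<zero>\<^bsub>M\<^esub>} \<and> P <+>\<^bsub>M\<^esub> Q = carrier M)"

text \<open>The direct sum of \<open>N\<close> copies of \<open>M\<close>.\<close>

definition bimodule_power ::
  "[('r, 'm, 's, 'z) bimodule_scheme, nat] \<Rightarrow> ('r, nat \<Rightarrow> 'm, 's) bimodule"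
  where "bimodule_power M N =
    \<lparr>carrier = {..<N} \<rightarrow>\<^sub>E carrier M, monoid.mult = undefined, monoid.one = undefined,
     ring.zero = (\<lambda>i\<in>{..<N}. \<zero>\<^bsub>M\<^esub>), ring.add = (\<lambda>v w. \<lambda>i\<in>{..<N}. v i \<oplus>\<^bsub>M\<^esub> w i),
     smult = (\<lambda>r v. \<lambda>i\<in>{..<N}. r \<odot>\<^bsub>M\<^esub> v i),
     rsmult = (\<lambda>v s. \<lambda>i\<in>{..<N}. v i \<triangleleft>\<^bsub>M\<^esub> s)\<rparr>"

text \<open>The tensor product \<open>M \<otimes>\<^sub>S L\<close> of an \<open>R\<close>-\<open>S\<close>-bimodule \<open>M\<close> and an \<open>S\<close>-\<open>T\<close>-bimodule \<open>L\<close>, as the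
  quotient of the free abelian group on \<open>M \<times> L\<close> by the usual relations. The free abelian group is
  written multiplicatively in the library, although its operation is \<open>+\<close> on \<open>\<int>\<close>-valued functions
  with finite support.\<close>

definition tensor_relations ::
  "[('s, 'y) ring_scheme, ('r, 'm, 's, 'z) bimodule_scheme, ('s, 'l, 't, 'w) bimodule_scheme]
    \<Rightarrow> ('m \<times> 'l \<Rightarrow>\<^sub>0 int) set"
  where "tensor_relations S M L =
    {frag_of (x \<oplus>\<^bsub>M\<^esub> x', y) - frag_of (x, y) - frag_of (x', y) | x x' y.
       x \<in> carrier M \<and> x' \<in> carrier M \<and> y \<in> carrier L} \<union>
    {frag_of (x, y \<oplus>\<^bsub>L\<^esub> y') - frag_of (x, y) - frag_of (x, y') | x y y'.
       x \<in> carrier M \<and> y \<in> carrier L \<and> y' \<in> carrier L} \<union>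
    {frag_of (x \<triangleleft>\<^bsub>M\<^esub> s, y) - frag_of (x, s \<odot>\<^bsub>L\<^esub> y) | x s y.
       x \<in> carrier M \<and> s \<in> carrier S \<and> y \<in> carrier L}"

definition tensor_kernel ::
  "[('s, 'y) ring_scheme, ('r, 'm, 's, 'z) bimodule_scheme, ('s, 'l, 't, 'w) bimodule_scheme]
    \<Rightarrow> ('m \<times> 'l \<Rightarrow>\<^sub>0 int) set"
  where "tensor_kernel S M L =
    generate (free_Abelian_group (carrier M \<times> carrier L)) (tensor_relations S M L)"

definition tensor_class ::
  "[('s, 'y) ring_scheme, ('r, 'm, 's, 'z) bimodule_scheme, ('s, 'l, 't, 'w) bimodule_scheme,
    'm \<times> 'l \<Rightarrow>\<^sub>0 int] \<Rightarrow> ('m \<times> 'l \<Rightarrow>\<^sub>0 int) set"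
  where "tensor_class S M L c =
    tensor_kernel S M L #>\<^bsub>free_Abelian_group (carrier M \<times> carrier L)\<^esub> c"

definition pure_tensor ::
  "[('s, 'y) ring_scheme, ('r, 'm, 's, 'z) bimodule_scheme, ('s, 'l, 't, 'w) bimodule_scheme,
    'm, 'l] \<Rightarrow> ('m \<times> 'l \<Rightarrow>\<^sub>0 int) set"
  where "pure_tensor S M L x y = tensor_class S M L (frag_of (x, y))"

text \<open>The actions are induced by \<open>r (x \<otimes> y) = r x \<otimes> y\<close> and \<open>(x \<otimes> y) t = x \<otimes> y t\<close>, extended
  additively to representatives. They do not depend on the representative, so each union below is
  over sets that are all equal to the same coset.\<close>

definition tensor_product ::
  "[('s, 'y) ring_scheme, ('r, 'm, 's, 'z) bimodule_scheme, ('s, 'l, 't, 'w) bimodule_scheme]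
    \<Rightarrow> ('r, ('m \<times> 'l \<Rightarrow>\<^sub>0 int) set, 't) bimodule"
  where "tensor_product S M L =
    (let Q = free_Abelian_group (carrier M \<times> carrier L) Mod tensor_kernel S M L in
     \<lparr>carrier = carrier Q, monoid.mult = undefined, monoid.one = undefined,
      ring.zero = \<one>\<^bsub>Q\<^esub>, ring.add = monoid.mult Q,
      smult = (\<lambda>r K. \<Union>c\<in>K. tensor_class S M L
                 (frag_extend (\<lambda>(x, y). frag_of (r \<odot>\<^bsub>M\<^esub> x, y)) c)),
      rsmult = (\<lambda>K t. \<Union>c\<in>K. tensor_class S M L
                 (frag_extend (\<lambda>(x, y). frag_of (x, y \<triangleleft>\<^bsub>L\<^esub> t)) c))\<rparr>)"

text \<open>The ring \<open>A\<close> regarded as an \<open>R\<close>-\<open>S\<close>-bimodule along \<open>\<phi> : R \<rightarrow> A\<close> and \<open>\<psi> : S \<rightarrow> A\<close>.\<close>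

definition ring_bimodule ::
  "[('a, 'x) ring_scheme, 'r \<Rightarrow> 'a, 's \<Rightarrow> 'a] \<Rightarrow> ('r, 'a, 's) bimodule"
  where "ring_bimodule A \<phi> \<psi> =
    \<lparr>carrier = carrier A, monoid.mult = monoid.mult A, monoid.one = \<one>\<^bsub>A\<^esub>,
     ring.zero = \<zero>\<^bsub>A\<^esub>, ring.add = add A,
     smult = (\<lambda>r x. \<phi> r \<otimes>\<^bsub>A\<^esub> x), rsmult = (\<lambda>x s. x \<otimes>\<^bsub>A\<^esub> \<psi> s)\<rparr>"

locale ring_tower = A: ring A + B: ring B + C: ring C
  for A :: "('a, 'x) ring_scheme" and B :: "('b, 'y) ring_scheme" and C :: "('c, 'z) ring_scheme"
    and g :: "'b \<Rightarrow> 'a" and f :: "'c \<Rightarrow> 'b" +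
  assumes hom_BA: "g \<in> ring_hom B A"
    and hom_CB: "f \<in> ring_hom C B"

definition tower_tensor ::
  "[('a, 'x) ring_scheme, ('b, 'y) ring_scheme, 'b \<Rightarrow> 'a, 'c \<Rightarrow> 'b]
    \<Rightarrow> ('a, ('a \<times> 'a \<Rightarrow>\<^sub>0 int) set, 'c) bimodule"
  where "tower_tensor A B g f =
    tensor_product B (ring_bimodule A id g) (ring_bimodule A g (g \<circ> f))"

definition tower_pure_tensor ::
  "[('a, 'x) ring_scheme, ('b, 'y) ring_scheme, 'b \<Rightarrow> 'a, 'c \<Rightarrow> 'b, 'a, 'a]
    \<Rightarrow> ('a \<times> 'a \<Rightarrow>\<^sub>0 int) set"
  where "tower_pure_tensor A B g f =
    pure_tensor B (ring_bimodule A id g) (ring_bimodule A g (g \<circ> f))"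

definition right_depth_three ::
  "[('a, 'x) ring_scheme, ('b, 'y) ring_scheme, ('c, 'z) ring_scheme, 'b \<Rightarrow> 'a, 'c \<Rightarrow> 'b] \<Rightarrow> bool"
  where "right_depth_three A B C g f \<longleftrightarrow>
    (\<exists>N>0. let AN = bimodule_power (ring_bimodule A id (g \<circ> f)) N in
       \<exists>P. direct_summand P A C AN \<and>
           bimodule_iso A C (tower_tensor A B g f) (AN\<lparr>carrier := P\<rparr>) \<noteq> {})"

definition tower_End ::
  "[('a, 'x) ring_scheme, ('b, 'y) ring_scheme, ('c, 'z) ring_scheme, 'b \<Rightarrow> 'a, 'c \<Rightarrow> 'b]
    \<Rightarrow> ('a \<Rightarrow> 'a) set"
  where "tower_End A B C g f =
    bimodule_hom B C (ring_bimodule A g (g \<circ> f)) (ring_bimodule A g (g \<circ> f))"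

text \<open>The left action of \<open>C\<close> on \<open>A \<otimes>\<^sub>B A\<close> is the restriction along \<open>g \<circ> f\<close> of the action of \<open>A\<close>.\<close>

definition tower_tensor_centralizer ::
  "[('a, 'x) ring_scheme, ('b, 'y) ring_scheme, ('c, 'z) ring_scheme, 'b \<Rightarrow> 'a, 'c \<Rightarrow> 'b]
    \<Rightarrow> ('a \<times> 'a \<Rightarrow>\<^sub>0 int) set set"
  where "tower_tensor_centralizer A B C g f =
    {m \<in> carrier (tower_tensor A B g f). \<forall>c\<in>carrier C.
       g (f c) \<odot>\<^bsub>tower_tensor A B g f\<^esub> m = m \<triangleleft>\<^bsub>tower_tensor A B g f\<^esub> c}"


text \<open>The constructions above yield bimodules; in particular the actions on the tensor product are
  well defined on cosets.\<close>

lemma ring_bimodule_bimodule: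
  assumes "ring A" "ring R" "ring S" "\<phi> \<in> ring_hom R A" "\<psi> \<in> ring_hom S A"
  shows "bimodule R S (ring_bimodule A \<phi> \<psi>)"
proof -
  interpret A: ring A by fact
  interpret R: ring R by fact
  interpret S: ring S by fact
  interpret \<phi>: ring_hom_ring R A \<phi> using assms by (simp add: ring_hom_ringI2)
  interpret \<psi>: ring_hom_ring S A \<psi> using assms by (simp add: ring_hom_ringI2)
  have "abelian_group (ring_bimodule A \<phi> \<psi>)"
    by (rule abelian_groupI)
      (auto simp: ring_bimodule_def A.a_ac intro: exI[of _ "\<ominus>\<^bsub>A\<^esub> _"] A.l_neg)
  then interpret M: abelian_group "ring_bimodule A \<phi> \<psi>" .
  show ?thesis
    by unfold_locales
      (auto simp: ring_bimodule_def A.l_distr A.r_distr A.m_assoc)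
qed

lemma bimodule_power_bimodule:
  assumes "bimodule R S M"
  shows "bimodule R S (bimodule_power M N)"
proof -
  interpret bimodule R S M by fact
  have "abelian_group (bimodule_power M N)"
  proof (rule abelian_groupI)
    fix x assume x: "x \<in> carrier (bimodule_power M N)"
    show "\<exists>y\<in>carrier (bimodule_power M N).
        y \<oplus>\<^bsub>bimodule_power M N\<^esub> x = \<zero>\<^bsub>bimodule_power M N\<^esub>"
      using x by (intro bexI[of _ "\<lambda>i\<in>{..<N}. \<ominus>\<^bsub>M\<^esub> x i"])
        (auto simp: bimodule_power_def M.l_neg fun_eq_iff PiE_iff)
  qed (auto simp: bimodule_power_def M.a_ac PiE_iff fun_eq_iff extensional_def)
  then interpret P: abelian_group "bimodule_power M N" .
  show ?thesis
  proof unfold_locales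
    show "\<one>\<^bsub>R\<^esub> \<odot>\<^bsub>bimodule_power M N\<^esub> x = x" "x \<triangleleft>\<^bsub>bimodule_power M N\<^esub> \<one>\<^bsub>S\<^esub> = x"
      if "x \<in> carrier (bimodule_power M N)" for x
      using that
      by (auto simp: bimodule_power_def PiE_iff extensional_def fun_eq_iff lsmult_one rsmult_one)
  qed (use lsmult_closed rsmult_closed in
      \<open>auto simp: bimodule_power_def PiE_iff intro!: restrict_ext lsmult_l_distr lsmult_r_distr lsmult_assoc
         rsmult_l_distr rsmult_r_distr rsmult_assoc lsmult_rsmult\<close>)
qed

locale bimodule_pair = M: bimodule R S M + L: bimodule S T L
  for R :: "('r, 'x) ring_scheme" and S :: "('s, 'y) ring_scheme" and T :: "('t, 'v) ring_scheme"
    and M :: "('r, 'm, 's, 'z) bimodule_scheme" and L :: "('s, 'l, 't, 'w) bimodule_scheme"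
begin

abbreviation "F \<equiv> free_Abelian_group (carrier M \<times> carrier L)"
abbreviation "K \<equiv> tensor_kernel S M L"
abbreviation "cls \<equiv> tensor_class S M L"
abbreviation "lext r \<equiv> frag_extend (\<lambda>(x, y). frag_of (r \<odot>\<^bsub>M\<^esub> x, y)) :: ('m \<times> 'l \<Rightarrow>\<^sub>0 int) \<Rightarrow> _"
abbreviation "rext t \<equiv> frag_extend (\<lambda>(x, y). frag_of (x, y \<triangleleft>\<^bsub>L\<^esub> t)) :: ('m \<times> 'l \<Rightarrow>\<^sub>0 int) \<Rightarrow> _"

lemma rel_carrier: "tensor_relations S M L \<subseteq> carrier F"
proof -
  have keys3: "Poly_Mapping.keys (frag_of a - frag_of b - frag_of c) \<subseteq> {a, b, c}" for a b c :: "'m \<times> 'l"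
    using keys_diff[of "frag_of a - frag_of b" "frag_of c"] keys_diff[of "frag_of a" "frag_of b"] by auto
  have keys2: "Poly_Mapping.keys (frag_of a - frag_of b) \<subseteq> {a, b}" for a b :: "'m \<times> 'l"
    using keys_diff[of "frag_of a" "frag_of b"] by auto
  show ?thesis
    unfolding tensor_relations_def
    by (auto dest!: subsetD[OF keys3] subsetD[OF keys2] simp: M.rsmult_closed L.lsmult_closed)
qed

lemma K_sub: "subgroup K F"
  unfolding tensor_kernel_def
  by (rule group.generate_is_subgroup[OF group_free_Abelian_group rel_carrier])

lemma K_carrier: "k \<in> K \<Longrightarrow> Poly_Mapping.keys k \<subseteq> carrier M \<times> carrier L"
  using subgroup.mem_carrier[OF K_sub, of k] by simp

lemma K_add: "a \<in> K \<Longrightarrow> b \<in> K \<Longrightarrow> a + b \<in> K"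
  using subgroup.m_closed[OF K_sub] by force
lemma K_zero: "0 \<in> K"
  using subgroup.one_closed[OF K_sub] by force
lemma K_uminus: "a \<in> K \<Longrightarrow> - a \<in> K"
  using subgroup.m_inv_closed[OF K_sub, of a] K_carrier[of a] by simp
lemma K_diff: "a \<in> K \<Longrightarrow> b \<in> K \<Longrightarrow> a - b \<in> K"
  using K_add[OF _ K_uminus] by fastforce
lemma K_rel: "a \<in> tensor_relations S M L \<Longrightarrow> a \<in> K"
  unfolding tensor_kernel_def by (rule generate.incl)

lemma cls_iff: "d \<in> cls c \<longleftrightarrow> d - c \<in> K"
  by (auto simp: tensor_class_def r_coset_def)
     (metis diff_add_cancel)

lemma cls_eq: "cls c = cls d \<longleftrightarrow> c - d \<in> K"
proof
  assume "cls c = cls d" then show "c - d \<in> K" using cls_iff[of c c] cls_iff K_zero by simp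
next
  assume *: "c - d \<in> K"
  have "e - c \<in> K \<longleftrightarrow> e - d \<in> K" for e
    using K_add[OF _ *, of "e - c"] K_diff[OF _ *, of "e - d"] by auto
  then show "cls c = cls d" by (auto simp: cls_iff)
qed

lemma K_image:
  assumes rel: "\<And>a. a \<in> tensor_relations S M L \<Longrightarrow> frag_extend h a \<in> K" and "k \<in> K"
  shows "frag_extend h k \<in> K"
  using assms(2) unfolding tensor_kernel_def
proof (induction k rule: generate.induct)
  case one show ?case using K_zero by (simp add: tensor_kernel_def)
next
  case (incl a) then show ?case using rel by (simp add: tensor_kernel_def)
next
  case (inv a)
  then have "inv\<^bsub>F\<^esub> a = - a" using rel_carrier by force
  then show ?case using K_uminus[OF rel[OF inv]] by (simp add: tensor_kernel_def frag_extend_minus)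
next
  case (eng a b) then show ?case using K_add by (simp add: tensor_kernel_def frag_extend_add)
qed

lemma rel1: "\<lbrakk>x \<in> carrier M; x' \<in> carrier M; y \<in> carrier L\<rbrakk>
    \<Longrightarrow> frag_of (x \<oplus>\<^bsub>M\<^esub> x', y) - frag_of (x, y) - frag_of (x', y) \<in> K"
  by (rule K_rel) (auto simp: tensor_relations_def)
lemma rel2: "\<lbrakk>x \<in> carrier M; y \<in> carrier L; y' \<in> carrier L\<rbrakk>
    \<Longrightarrow> frag_of (x, y \<oplus>\<^bsub>L\<^esub> y') - frag_of (x, y) - frag_of (x, y') \<in> K"
  by (rule K_rel) (auto simp: tensor_relations_def)
lemma rel3: "\<lbrakk>x \<in> carrier M; s \<in> carrier S; y \<in> carrier L\<rbrakk>
    \<Longrightarrow> frag_of (x \<triangleleft>\<^bsub>M\<^esub> s, y) - frag_of (x, s \<odot>\<^bsub>L\<^esub> y) \<in> K"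
  by (rule K_rel) (auto simp: tensor_relations_def)

lemma lext_K: assumes r: "r \<in> carrier R" and "k \<in> K" shows "lext r k \<in> K"
proof (rule K_image[OF _ assms(2)])
  fix a assume "a \<in> tensor_relations S M L"
  then show "lext r a \<in> K"
    using r unfolding tensor_relations_def
    by (auto simp: frag_extend_diff M.lsmult_r_distr M.lsmult_closed M.lsmult_rsmult[symmetric]
        intro!: rel1 rel2 rel3)
qed

lemma rext_K: assumes t: "t \<in> carrier T" and "k \<in> K" shows "rext t k \<in> K"
proof (rule K_image[OF _ assms(2)])
  fix a assume "a \<in> tensor_relations S M L"
  then show "rext t a \<in> K"
    using t unfolding tensor_relations_def
    by (auto simp: frag_extend_diff L.rsmult_l_distr L.rsmult_closed L.lsmult_rsmult
        intro!: rel1 rel2 rel3)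
qed

lemma smult_cls: "r \<in> carrier R \<Longrightarrow> r \<odot>\<^bsub>tensor_product S M L\<^esub> cls c = cls (lext r c)"
proof -
  assume r: "r \<in> carrier R"
  have "cls (lext r d) = cls (lext r c)" if "d \<in> cls c" for d
    using lext_K[OF r, of "d - c"] that by (simp add: cls_iff cls_eq frag_extend_diff)
  moreover have "c \<in> cls c" by (simp add: cls_iff K_zero)
  ultimately have "(\<Union>d\<in>cls c. cls (lext r d)) = cls (lext r c)" by fast
  then show ?thesis by (simp add: tensor_product_def Let_def)
qed

lemma rsmult_cls: "t \<in> carrier T \<Longrightarrow> cls c \<triangleleft>\<^bsub>tensor_product S M L\<^esub> t = cls (rext t c)"
proof -
  assume t: "t \<in> carrier T"
  have "cls (rext t d) = cls (rext t c)" if "d \<in> cls c" for d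
    using rext_K[OF t, of "d - c"] that by (simp add: cls_iff cls_eq frag_extend_diff)
  moreover have "c \<in> cls c" by (simp add: cls_iff K_zero)
  ultimately have "(\<Union>d\<in>cls c. cls (rext t d)) = cls (rext t c)" by fast
  then show ?thesis by (simp add: tensor_product_def Let_def)
qed

lemma K_normal: "K \<lhd> F"
  by (simp add: K_sub abelian_free_Abelian_group comm_group.normal_iff_subgroup)

lemma add_cls: "\<lbrakk>c \<in> carrier F; d \<in> carrier F\<rbrakk>
    \<Longrightarrow> cls c \<oplus>\<^bsub>tensor_product S M L\<^esub> cls d = cls (c + d)"
  using normal.rcos_sum[OF K_normal] by (simp add: tensor_product_def Let_def tensor_class_def)

lemma carrier_tensor: "carrier (tensor_product S M L) = cls ` carrier F"
  by (auto simp: tensor_product_def Let_def carrier_FactGroup tensor_class_def)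

lemma zero_tensor: "\<zero>\<^bsub>tensor_product S M L\<^esub> = cls 0"
  by (auto simp: tensor_product_def Let_def tensor_class_def r_coset_def)

lemma lext_carrier: "r \<in> carrier R \<Longrightarrow> c \<in> carrier F \<Longrightarrow> lext r c \<in> carrier F"
  using keys_frag_extend[of "\<lambda>(x, y). frag_of (r \<odot>\<^bsub>M\<^esub> x, y)" c]
  by (fastforce simp: M.lsmult_closed)

lemma rext_carrier: "t \<in> carrier T \<Longrightarrow> c \<in> carrier F \<Longrightarrow> rext t c \<in> carrier F"
  using keys_frag_extend[of "\<lambda>(x, y). frag_of (x, y \<triangleleft>\<^bsub>L\<^esub> t)" c]
  by (fastforce simp: L.rsmult_closed)

lemma K_induct:
  assumes "c \<in> carrier F" "h 0 = 0" "\<And>a b. h (a - b) = h a - h b"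
    "\<And>x y. x \<in> carrier M \<Longrightarrow> y \<in> carrier L \<Longrightarrow> h (frag_of (x, y)) \<in> K"
  shows "h c \<in> K"
  by (rule free_Abelian_group_induct[where S = "carrier M \<times> carrier L" and P = "\<lambda>c. h c \<in> K"])
     (use assms K_zero K_diff in auto)

lemma tensor_bimodule: "bimodule R T (tensor_product S M L)"
proof -
  let ?T = "tensor_product S M L"
  have cm: "comm_group (F Mod K)"
    by (simp add: K_sub abelian_free_Abelian_group comm_group.abelian_FactGroup)
  interpret Q: comm_group "F Mod K" by fact
  have eqs: "carrier ?T = carrier (F Mod K)" "add ?T = monoid.mult (F Mod K)" "\<zero>\<^bsub>?T\<^esub> = \<one>\<^bsub>F Mod K\<^esub>"
    by (simp_all add: tensor_product_def Let_def)
  have "abelian_group ?T"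
    by (rule abelian_groupI; unfold eqs)
      (fact Q.m_closed Q.one_closed Q.m_assoc Q.m_comm Q.l_one Q.l_inv_ex)+
  then interpret Ab: abelian_group ?T .
  note [simp] = smult_cls rsmult_cls
  have ac: "a + b \<in> carrier F" if "a \<in> carrier F" "b \<in> carrier F" for a b
    using that keys_add[of a b] by auto
  show ?thesis
  proof unfold_locales
    fix r r' x assume a: "r \<in> carrier R" "r' \<in> carrier R" "x \<in> carrier ?T"
    then obtain c where c: "c \<in> carrier F" "x = cls c" by (auto simp: carrier_tensor)
    have "lext (r \<oplus>\<^bsub>R\<^esub> r') c - (lext r c + lext r' c) \<in> K"
      by (rule K_induct[OF c(1), of "\<lambda>c. lext (r \<oplus>\<^bsub>R\<^esub> r') c - (lext r c + lext r' c)"])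
        (use a in \<open>auto simp: frag_extend_diff M.lsmult_l_distr M.lsmult_closed diff_diff_eq[symmetric]
          intro!: rel1\<close>)
    then show "(r \<oplus>\<^bsub>R\<^esub> r') \<odot>\<^bsub>?T\<^esub> x = r \<odot>\<^bsub>?T\<^esub> x \<oplus>\<^bsub>?T\<^esub> r' \<odot>\<^bsub>?T\<^esub> x"
      using a c(1) unfolding c(2)
      by (simp del: carrier_free_Abelian_group_iff add: add_cls lext_carrier cls_eq)
    have "lext (r \<otimes>\<^bsub>R\<^esub> r') c - lext r (lext r' c) \<in> K"
      by (rule K_induct[OF c(1), of "\<lambda>c. lext (r \<otimes>\<^bsub>R\<^esub> r') c - lext r (lext r' c)"])
        (use a in \<open>auto simp: frag_extend_diff M.lsmult_assoc K_zero\<close>)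
    then show "(r \<otimes>\<^bsub>R\<^esub> r') \<odot>\<^bsub>?T\<^esub> x = r \<odot>\<^bsub>?T\<^esub> (r' \<odot>\<^bsub>?T\<^esub> x)"
      using a c(1) unfolding c(2) by (simp add: cls_eq)
  next
    fix r x y assume a: "r \<in> carrier R" "x \<in> carrier ?T" "y \<in> carrier ?T"
    then obtain c d where c: "c \<in> carrier F" "x = cls c" "d \<in> carrier F" "y = cls d"
      by (auto simp: carrier_tensor)
    show "r \<odot>\<^bsub>?T\<^esub> (x \<oplus>\<^bsub>?T\<^esub> y) = r \<odot>\<^bsub>?T\<^esub> x \<oplus>\<^bsub>?T\<^esub> r \<odot>\<^bsub>?T\<^esub> y"
      using a c(1,3) unfolding c(2,4)
      by (simp del: carrier_free_Abelian_group_iff add: add_cls lext_carrier frag_extend_add)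
  next
    fix x t t' assume a: "x \<in> carrier ?T" "t \<in> carrier T" "t' \<in> carrier T"
    then obtain c where c: "c \<in> carrier F" "x = cls c" by (auto simp: carrier_tensor)
    have "rext (t \<oplus>\<^bsub>T\<^esub> t') c - (rext t c + rext t' c) \<in> K"
      by (rule K_induct[OF c(1), of "\<lambda>c. rext (t \<oplus>\<^bsub>T\<^esub> t') c - (rext t c + rext t' c)"])
        (use a in \<open>auto simp: frag_extend_diff L.rsmult_r_distr L.rsmult_closed diff_diff_eq[symmetric]
          intro!: rel2\<close>)
    then show "x \<triangleleft>\<^bsub>?T\<^esub> (t \<oplus>\<^bsub>T\<^esub> t') = x \<triangleleft>\<^bsub>?T\<^esub> t \<oplus>\<^bsub>?T\<^esub> x \<triangleleft>\<^bsub>?T\<^esub> t'"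
      using a c(1) unfolding c(2)
      by (simp del: carrier_free_Abelian_group_iff add: add_cls rext_carrier cls_eq)
    have "rext (t \<otimes>\<^bsub>T\<^esub> t') c - rext t' (rext t c) \<in> K"
      by (rule K_induct[OF c(1), of "\<lambda>c. rext (t \<otimes>\<^bsub>T\<^esub> t') c - rext t' (rext t c)"])
        (use a in \<open>auto simp: frag_extend_diff L.rsmult_assoc K_zero\<close>)
    then show "x \<triangleleft>\<^bsub>?T\<^esub> (t \<otimes>\<^bsub>T\<^esub> t') = (x \<triangleleft>\<^bsub>?T\<^esub> t) \<triangleleft>\<^bsub>?T\<^esub> t'"
      using a c(1) unfolding c(2) by (simp add: cls_eq)
  next
    fix x y t assume a: "x \<in> carrier ?T" "y \<in> carrier ?T" "t \<in> carrier T"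
    then obtain c d where c: "c \<in> carrier F" "x = cls c" "d \<in> carrier F" "y = cls d"
      by (auto simp: carrier_tensor)
    show "(x \<oplus>\<^bsub>?T\<^esub> y) \<triangleleft>\<^bsub>?T\<^esub> t = x \<triangleleft>\<^bsub>?T\<^esub> t \<oplus>\<^bsub>?T\<^esub> y \<triangleleft>\<^bsub>?T\<^esub> t"
      using a c(1,3) unfolding c(2,4)
      by (simp del: carrier_free_Abelian_group_iff add: add_cls rext_carrier frag_extend_add)
  next
    fix r x t assume a: "r \<in> carrier R" "x \<in> carrier ?T" "t \<in> carrier T"
    then obtain c where c: "c \<in> carrier F" "x = cls c" by (auto simp: carrier_tensor)
    have "rext t (lext r c) - lext r (rext t c) \<in> K"
      by (rule K_induct[OF c(1), of "\<lambda>c. rext t (lext r c) - lext r (rext t c)"])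
        (auto simp: frag_extend_diff K_zero)
    then show "(r \<odot>\<^bsub>?T\<^esub> x) \<triangleleft>\<^bsub>?T\<^esub> t = r \<odot>\<^bsub>?T\<^esub> (x \<triangleleft>\<^bsub>?T\<^esub> t)"
      using a c(1) unfolding c(2) by (simp add: cls_eq)
  next
    fix r x assume a: "r \<in> carrier R" "x \<in> carrier ?T"
    then show "r \<odot>\<^bsub>?T\<^esub> x \<in> carrier ?T"
      by (auto simp del: carrier_free_Abelian_group_iff simp: carrier_tensor lext_carrier)
  next
    fix x t assume a: "x \<in> carrier ?T" "t \<in> carrier T"
    then show "x \<triangleleft>\<^bsub>?T\<^esub> t \<in> carrier ?T"
      by (auto simp del: carrier_free_Abelian_group_iff simp: carrier_tensor rext_carrier)
  next
    fix x assume a: "x \<in> carrier ?T"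
    then obtain c where c: "c \<in> carrier F" "x = cls c" by (auto simp: carrier_tensor)
    have "lext \<one>\<^bsub>R\<^esub> c - c \<in> K"
      by (rule K_induct[OF c(1), of "\<lambda>c. lext \<one>\<^bsub>R\<^esub> c - c"])
        (auto simp: frag_extend_diff K_zero M.lsmult_one)
    then show "\<one>\<^bsub>R\<^esub> \<odot>\<^bsub>?T\<^esub> x = x" unfolding c(2) by (simp add: cls_eq)
    have "rext \<one>\<^bsub>T\<^esub> c - c \<in> K"
      by (rule K_induct[OF c(1), of "\<lambda>c. rext \<one>\<^bsub>T\<^esub> c - c"])
        (auto simp: frag_extend_diff K_zero L.rsmult_one)
    then show "x \<triangleleft>\<^bsub>?T\<^esub> \<one>\<^bsub>T\<^esub> = x" unfolding c(2) by (simp add: cls_eq)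
  qed
qed

end

lemma (in ring_tower) tower_tensor_bimodule: "bimodule A C (tower_tensor A B g f)"
proof -
  have h: "id \<in> ring_hom A A" "g \<circ> f \<in> ring_hom C A"
    by (simp add: ring_hom_def) (rule ring_hom_trans[OF hom_CB hom_BA])
  interpret bimodule_pair A B C "ring_bimodule A id g" "ring_bimodule A g (g \<circ> f)"
    by (intro bimodule_pair.intro ring_bimodule_bimodule A.ring_axioms B.ring_axioms C.ring_axioms
        h hom_BA)
  show ?thesis unfolding tower_tensor_def by (rule tensor_bimodule)
qed

end

theory Submission
  imports Defs
begin

text \<open>
  Write \<open>T\<close> for the \<open>A\<close>-\<open>C\<close>-bimodule \<open>A \<otimes>\<^sub>B A\<close>. Being isomorphic to a direct summand of \<open>A\<^sup>N\<close> is the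
  same as being a retract of it (\<open>iso_direct_summand_iff_retract\<close>), and a retraction from \<open>A\<^sup>N\<close> has
  coordinates: bimodule homomorphisms \<open>h\<^sub>i : T \<rightarrow> A\<close> and \<open>k\<^sub>i : A \<rightarrow> T\<close> with \<open>\<Sum> k\<^sub>i \<circ> h\<^sub>i = id\<close>
  (\<open>retract_of_power_iff\<close>).

  Both kinds of homomorphism are familiar objects. By the universal property of the tensor product
  (\<open>tensor_lift\<close>), homomorphisms \<open>T \<rightarrow> A\<close> correspond to endomorphisms \<open>\<gamma>\<close> of \<open>A\<close> as a
  \<open>B\<close>-\<open>C\<close>-bimodule: \<open>h\<close> gives \<open>\<gamma> y = h (1 \<otimes> y)\<close>, and \<open>\<gamma>\<close> gives \<open>h (x \<otimes> y) = x \<gamma>(y)\<close>. Homomorphisms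
  \<open>A \<rightarrow> T\<close> are determined by the image \<open>u\<close> of \<open>1\<close>, and \<open>a \<mapsto> a u\<close> respects the right action of \<open>C\<close>
  exactly when \<open>u\<close> commutes with \<open>C\<close>.

  Under these correspondences \<open>k\<^sub>i (h\<^sub>i (x \<otimes> y)) = x \<gamma>\<^sub>i(y) u\<^sub>i\<close>. Pure tensors generate \<open>T\<close>, so
  \<open>\<Sum> k\<^sub>i \<circ> h\<^sub>i = id\<close> need only be tested on them (\<open>sum_hom_eq_id_iff\<close>), where it is the required identity.
\<close>

section \<open>Differences in abelian groups\<close>

lemma (in abelian_group) add_minus_cancel_left:
  "\<lbrakk>p \<in> carrier G; q \<in> carrier G\<rbrakk> \<Longrightarrow> (p \<oplus> q) \<ominus> p = q"
  by (simp add: a_minus_def a_comm[of p q] a_assoc r_neg)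

lemma (in abelian_group) add_minus_cancel_right:
  "\<lbrakk>p \<in> carrier G; q \<in> carrier G\<rbrakk> \<Longrightarrow> p \<oplus> (q \<ominus> p) = q"
  by (simp add: a_minus_def a_comm[of p] a_assoc l_neg)

lemma (in abelian_group) minus_minus_minus:
  "\<lbrakk>m \<in> carrier G; a \<in> carrier G; b \<in> carrier G\<rbrakk> \<Longrightarrow> (m \<ominus> b) \<oplus> \<ominus> (m \<ominus> a) = a \<ominus> b"
  by (simp add: a_minus_def minus_add a_assoc a_lcomm[of "\<ominus> b" "\<ominus> m"] r_neg2 a_comm[of "\<ominus> b" a])

lemma (in abelian_group) add_minus_add:
  "\<lbrakk>x \<in> carrier G; y \<in> carrier G; a \<in> carrier G; b \<in> carrier G\<rbrakk>
    \<Longrightarrow> (x \<oplus> y) \<ominus> (a \<oplus> b) = (x \<ominus> a) \<oplus> (y \<ominus> b)"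
  by (simp add: a_minus_def minus_add a_ac)

lemma (in abelian_group) minus_self:
  "a \<in> carrier G \<Longrightarrow> a \<ominus> a = \<zero>"
  by (simp add: a_minus_def r_neg)

lemma (in abelian_group) minus_zero_eq:
  "\<lbrakk>a \<in> carrier G; b \<in> carrier G; a \<ominus> b = \<zero>\<rbrakk> \<Longrightarrow> a = b"
  by (metis add_minus_cancel_right r_zero)

section \<open>Bimodule homomorphisms\<close>

lemma bimodule_homI:
  assumes "\<And>x. x \<in> carrier M \<Longrightarrow> h x \<in> carrier N"
    and "\<And>x y. \<lbrakk>x \<in> carrier M; y \<in> carrier M\<rbrakk> \<Longrightarrow> h (x \<oplus>\<^bsub>M\<^esub> y) = h x \<oplus>\<^bsub>N\<^esub> h y"
    and "\<And>r x. \<lbrakk>r \<in> carrier R; x \<in> carrier M\<rbrakk> \<Longrightarrow> h (r \<odot>\<^bsub>M\<^esub> x) = r \<odot>\<^bsub>N\<^esub> h x"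
    and "\<And>x s. \<lbrakk>x \<in> carrier M; s \<in> carrier S\<rbrakk> \<Longrightarrow> h (x \<triangleleft>\<^bsub>M\<^esub> s) = h x \<triangleleft>\<^bsub>N\<^esub> s"
  shows "h \<in> bimodule_hom R S M N"
  using assms by (auto simp: bimodule_hom_def)

lemma bimodule_homD:
  assumes "h \<in> bimodule_hom R S M N"
  shows "x \<in> carrier M \<Longrightarrow> h x \<in> carrier N"
    and "\<lbrakk>x \<in> carrier M; y \<in> carrier M\<rbrakk> \<Longrightarrow> h (x \<oplus>\<^bsub>M\<^esub> y) = h x \<oplus>\<^bsub>N\<^esub> h y"
    and "\<lbrakk>r \<in> carrier R; x \<in> carrier M\<rbrakk> \<Longrightarrow> h (r \<odot>\<^bsub>M\<^esub> x) = r \<odot>\<^bsub>N\<^esub> h x"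
    and "\<lbrakk>x \<in> carrier M; s \<in> carrier S\<rbrakk> \<Longrightarrow> h (x \<triangleleft>\<^bsub>M\<^esub> s) = h x \<triangleleft>\<^bsub>N\<^esub> s"
  using assms by (auto simp: bimodule_hom_def)

lemma bimodule_hom_comp:
  assumes "h \<in> bimodule_hom R S M N" "k \<in> bimodule_hom R S N L"
  shows "(\<lambda>x. k (h x)) \<in> bimodule_hom R S M L"
  using assms by (auto simp: bimodule_hom_def Pi_iff)

lemma additive_abelian_group_hom:
  assumes "abelian_group M" "abelian_group N"
    and "\<And>x. x \<in> carrier M \<Longrightarrow> h x \<in> carrier N"
    and "\<And>x y. \<lbrakk>x \<in> carrier M; y \<in> carrier M\<rbrakk> \<Longrightarrow> h (x \<oplus>\<^bsub>M\<^esub> y) = h x \<oplus>\<^bsub>N\<^esub> h y"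
  shows "abelian_group_hom M N h"
  using assms
  by (intro abelian_group_homI group_hom.intro group_hom_axioms.intro abelian_group.a_group homI) auto

lemma bimodule_hom_abelian_group_hom:
  assumes "bimodule R S M" "bimodule R S N" "h \<in> bimodule_hom R S M N"
  shows "abelian_group_hom M N h"
  by (rule additive_abelian_group_hom[OF bimodule.axioms(3)[OF assms(1)] bimodule.axioms(3)[OF assms(2)]])
    (simp_all add: bimodule_homD[OF assms(3)])

lemma (in abelian_group_hom) hom_minus:
  "\<lbrakk>x \<in> carrier G; y \<in> carrier G\<rbrakk> \<Longrightarrow> h (x \<ominus>\<^bsub>G\<^esub> y) = h x \<ominus>\<^bsub>H\<^esub> h y"
  by (simp add: a_minus_def)

lemma (in abelian_group_hom) hom_finsum:
  assumes "F \<in> I \<rightarrow> carrier G"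
  shows "h (finsum G F I) = finsum H (\<lambda>i. h (F i)) I"
  using assms
proof (induction I rule: infinite_finite_induct)
  case (insert i I)
  then have "F i \<in> carrier G" "F \<in> I \<rightarrow> carrier G" "(\<lambda>i. h (F i)) \<in> I \<rightarrow> carrier H"
    by (auto simp: Pi_iff)
  with insert show ?case
    by simp
qed simp_all

lemma (in bimodule) lsmult_abelian_group_hom:
  "r \<in> carrier R \<Longrightarrow> abelian_group_hom M M (\<lambda>x. r \<odot> x)"
  by (rule additive_abelian_group_hom[OF M.abelian_group_axioms M.abelian_group_axioms])
    (simp_all add: lsmult_closed lsmult_r_distr)

lemma (in bimodule) rsmult_abelian_group_hom:
  "s \<in> carrier S \<Longrightarrow> abelian_group_hom M M (\<lambda>x. x \<triangleleft> s)"
  by (rule additive_abelian_group_hom[OF M.abelian_group_axioms M.abelian_group_axioms])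
    (simp_all add: rsmult_closed rsmult_l_distr)

lemma subbimoduleI:
  assumes "bimodule R S M" "P \<subseteq> carrier M" "\<zero>\<^bsub>M\<^esub> \<in> P"
    and "\<And>x y. \<lbrakk>x \<in> P; y \<in> P\<rbrakk> \<Longrightarrow> x \<oplus>\<^bsub>M\<^esub> y \<in> P"
    and l: "\<And>r x. \<lbrakk>r \<in> carrier R; x \<in> P\<rbrakk> \<Longrightarrow> r \<odot>\<^bsub>M\<^esub> x \<in> P"
    and "\<And>x s. \<lbrakk>x \<in> P; s \<in> carrier S\<rbrakk> \<Longrightarrow> x \<triangleleft>\<^bsub>M\<^esub> s \<in> P"
  shows "subbimodule P R S M"
proof -
  interpret bimodule R S M by fact
  have "\<ominus>\<^bsub>M\<^esub> x \<in> P" if x: "x \<in> P" for x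
  proof -
    have xM: "x \<in> carrier M" using x assms(2) by blast
    \<comment> \<open>Closure under negation comes for free: negation is the action of \<open>-1\<close>.\<close>
    have "(\<ominus>\<^bsub>R\<^esub> \<one>\<^bsub>R\<^esub>) \<odot>\<^bsub>M\<^esub> x \<oplus>\<^bsub>M\<^esub> x = (\<ominus>\<^bsub>R\<^esub> \<one>\<^bsub>R\<^esub> \<oplus>\<^bsub>R\<^esub> \<one>\<^bsub>R\<^esub>) \<odot>\<^bsub>M\<^esub> x"
      using xM by (simp add: lsmult_l_distr lsmult_one)
    also have "\<dots> = \<zero>\<^bsub>R\<^esub> \<odot>\<^bsub>M\<^esub> x" by (simp add: R.l_neg)
    also have "\<dots> = \<zero>\<^bsub>M\<^esub>"
      using lsmult_l_distr[of "\<zero>\<^bsub>R\<^esub>" "\<zero>\<^bsub>R\<^esub>" x] xM lsmult_closed[of "\<zero>\<^bsub>R\<^esub>" x]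
      by (simp add: M.add.l_cancel_one)
    finally have "\<ominus>\<^bsub>M\<^esub> x = (\<ominus>\<^bsub>R\<^esub> \<one>\<^bsub>R\<^esub>) \<odot>\<^bsub>M\<^esub> x"
      using xM by (intro M.minus_equality) (simp_all add: lsmult_closed)
    then show ?thesis using l x by simp
  qed
  then show ?thesis
    using assms
    by (auto intro!: subbimodule.intro submodule.intro subgroup.intro subbimodule_axioms.intro
        submodule_axioms.intro simp: a_inv_def[symmetric])
qed

text \<open>A retraction \<open>k\<close> of \<open>h\<close> splits its target as the image of \<open>h\<close> plus the kernel of \<open>k\<close>.
  Conversely, in a decomposition of \<open>M\<close> with complement \<open>Q\<close>, projection onto the summand followed
  by the inverse of the isomorphism sends \<open>m\<close> to the only \<open>t\<close> with \<open>m - h t \<in> Q\<close>.\<close>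

lemma iso_direct_summand_iff_retract:
  assumes "bimodule R S T" "bimodule R S M"
  shows "(\<exists>P. direct_summand P R S M \<and> bimodule_iso R S T (M\<lparr>carrier := P\<rparr>) \<noteq> {}) \<longleftrightarrow>
    (\<exists>h\<in>bimodule_hom R S T M. \<exists>k\<in>bimodule_hom R S M T. \<forall>t\<in>carrier T. k (h t) = t)"
    (is "?L \<longleftrightarrow> ?R")
proof
  interpret T: bimodule R S T by fact
  interpret M: bimodule R S M by fact
  {
    assume ?L
    then obtain P h where P: "direct_summand P R S M" and h: "h \<in> bimodule_iso R S T (M\<lparr>carrier := P\<rparr>)"
      by blast
    then obtain Q where PQ: "subbimodule P R S M" "subbimodule Q R S M" "P \<inter> Q = {\<zero>\<^bsub>M\<^esub>}"
      "P <+>\<^bsub>M\<^esub> Q = carrier M"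
      by (auto simp: direct_summand_def)
    interpret P: subbimodule P R S M by fact
    interpret Q: subbimodule Q R S M by fact
    have PM: "P \<subseteq> carrier M" and QM: "Q \<subseteq> carrier M"
      using P.subset Q.subset by auto
    have bij: "bij_betw h (carrier T) P" and hP: "h \<in> bimodule_hom R S T (M\<lparr>carrier := P\<rparr>)"
      using h by (auto simp: bimodule_iso_def)
    then have hM: "h \<in> bimodule_hom R S T M"
      using PM by (auto simp: bimodule_hom_def)
    interpret h: abelian_group_hom T M h
      using bimodule_hom_abelian_group_hom[OF assms hM] .
    have hmem: "h t \<in> P" if "t \<in> carrier T" for t
      using bij that by (auto simp: bij_betw_def)
    define k where "k m = (THE t. t \<in> carrier T \<and> m \<ominus>\<^bsub>M\<^esub> h t \<in> Q)" for m
    \<comment> \<open>Uniqueness of \<open>t\<close>: two candidates differ by an element that \<open>h\<close> maps into \<open>P \<inter> Q\<close>.\<close>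
    have kI: "k m = t" if t: "t \<in> carrier T" and m: "m \<in> carrier M" "m \<ominus>\<^bsub>M\<^esub> h t \<in> Q" for m t
      unfolding k_def
    proof (rule the_equality)
      fix t' assume t': "t' \<in> carrier T \<and> m \<ominus>\<^bsub>M\<^esub> h t' \<in> Q"
      have "h (t \<ominus>\<^bsub>T\<^esub> t') = (m \<ominus>\<^bsub>M\<^esub> h t') \<oplus>\<^bsub>M\<^esub> \<ominus>\<^bsub>M\<^esub> (m \<ominus>\<^bsub>M\<^esub> h t)"
        using t t' m
        by (simp add: h.hom_minus M.M.minus_minus_minus)
      also have "\<dots> \<in> Q"
        using t' m Q.m_closed Q.m_inv_closed by (simp add: a_inv_def)
      finally have "h (t \<ominus>\<^bsub>T\<^esub> t') \<in> P \<inter> Q"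
        using t t' hmem by simp
      then have "h t \<ominus>\<^bsub>M\<^esub> h t' = \<zero>\<^bsub>M\<^esub>"
        using PQ(3) t t' by (simp add: h.hom_minus)
      then have "h t = h t'"
        using M.M.minus_zero_eq t t' by simp
      then show "t' = t"
        using bij t t' by (auto simp: bij_betw_def inj_on_def)
    qed (use t m in simp)
    have kE: "\<exists>t\<in>carrier T. k m = t \<and> m \<ominus>\<^bsub>M\<^esub> h t \<in> Q" if m: "m \<in> carrier M" for m
    proof -
      obtain p q where pq: "p \<in> P" "q \<in> Q" "m = p \<oplus>\<^bsub>M\<^esub> q"
        using m PQ(4) unfolding set_add_def' by blast
      then obtain t where t: "t \<in> carrier T" "p = h t"
        using bij by (auto simp: bij_betw_def)
      have "m \<ominus>\<^bsub>M\<^esub> h t = q"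
        using pq t PM QM M.M.add_minus_cancel_left by auto
      then show ?thesis using t pq m kI by auto
    qed
    have "k \<in> bimodule_hom R S M T"
    proof (rule bimodule_homI)
      show "k x \<in> carrier T" if "x \<in> carrier M" for x
        using kE[OF that] by auto
    next
      fix x y assume xy: "x \<in> carrier M" "y \<in> carrier M"
      obtain s t where st: "s \<in> carrier T" "k x = s" "x \<ominus>\<^bsub>M\<^esub> h s \<in> Q"
        "t \<in> carrier T" "k y = t" "y \<ominus>\<^bsub>M\<^esub> h t \<in> Q"
        using kE[OF xy(1)] kE[OF xy(2)] by blast
      have "(x \<oplus>\<^bsub>M\<^esub> y) \<ominus>\<^bsub>M\<^esub> h (s \<oplus>\<^bsub>T\<^esub> t) = (x \<ominus>\<^bsub>M\<^esub> h s) \<oplus>\<^bsub>M\<^esub> (y \<ominus>\<^bsub>M\<^esub> h t)"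
        using xy st by (simp add: M.M.add_minus_add)
      also have "\<dots> \<in> Q" using st Q.m_closed by simp
      finally show "k (x \<oplus>\<^bsub>M\<^esub> y) = k x \<oplus>\<^bsub>T\<^esub> k y"
        using st xy by (intro kI) auto
    next
      fix r x assume rx: "r \<in> carrier R" "x \<in> carrier M"
      interpret r: abelian_group_hom M M "\<lambda>x. r \<odot>\<^bsub>M\<^esub> x"
        using M.lsmult_abelian_group_hom rx by simp
      obtain t where t: "t \<in> carrier T" "k x = t" "x \<ominus>\<^bsub>M\<^esub> h t \<in> Q"
        using kE[OF rx(2)] by blast
      have "r \<odot>\<^bsub>M\<^esub> x \<ominus>\<^bsub>M\<^esub> h (r \<odot>\<^bsub>T\<^esub> t) = r \<odot>\<^bsub>M\<^esub> (x \<ominus>\<^bsub>M\<^esub> h t)"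
        using rx t by (simp add: r.hom_minus bimodule_homD(3)[OF hM])
      also have "\<dots> \<in> Q" using t rx by simp
      finally show "k (r \<odot>\<^bsub>M\<^esub> x) = r \<odot>\<^bsub>T\<^esub> k x"
        using t rx by (intro kI) (auto simp: T.lsmult_closed)
    next
      fix x s assume sx: "x \<in> carrier M" "s \<in> carrier S"
      interpret s: abelian_group_hom M M "\<lambda>x. x \<triangleleft>\<^bsub>M\<^esub> s"
        using M.rsmult_abelian_group_hom sx by simp
      obtain t where t: "t \<in> carrier T" "k x = t" "x \<ominus>\<^bsub>M\<^esub> h t \<in> Q"
        using kE[OF sx(1)] by blast
      have "x \<triangleleft>\<^bsub>M\<^esub> s \<ominus>\<^bsub>M\<^esub> h (t \<triangleleft>\<^bsub>T\<^esub> s) = (x \<ominus>\<^bsub>M\<^esub> h t) \<triangleleft>\<^bsub>M\<^esub> s"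
        using sx t by (simp add: s.hom_minus bimodule_homD(4)[OF hM])
      also have "\<dots> \<in> Q" using t sx Q.rsmult_closed by simp
      finally show "k (x \<triangleleft>\<^bsub>M\<^esub> s) = k x \<triangleleft>\<^bsub>T\<^esub> s"
        using t sx by (intro kI) (auto simp: T.rsmult_closed)
    qed
    moreover have "k (h t) = t" if "t \<in> carrier T" for t
      using that Q.one_closed by (intro kI) (auto simp: M.M.minus_self)
    ultimately show ?R
      using hM by blast
  next
    assume ?R
    then obtain h k where hM: "h \<in> bimodule_hom R S T M" and kT: "k \<in> bimodule_hom R S M T"
      and kh: "\<And>t. t \<in> carrier T \<Longrightarrow> k (h t) = t"
      by blast
    interpret h: abelian_group_hom T M h
      using bimodule_hom_abelian_group_hom[OF assms hM] .
    interpret k: abelian_group_hom M T k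
      using bimodule_hom_abelian_group_hom[OF assms(2,1) kT] .
    note hD = bimodule_homD[OF hM] and kD = bimodule_homD[OF kT]
    define P where "P = h ` carrier T"
    define Q where "Q = {m \<in> carrier M. k m = \<zero>\<^bsub>T\<^esub>}"
    have P: "subbimodule P R S M"
    proof (rule subbimoduleI[OF assms(2)])
      show "P \<subseteq> carrier M" by (auto simp: P_def)
      show "\<zero>\<^bsub>M\<^esub> \<in> P" unfolding P_def by (rule image_eqI[of _ _ "\<zero>\<^bsub>T\<^esub>"]) auto
      show "x \<oplus>\<^bsub>M\<^esub> y \<in> P" if "x \<in> P" "y \<in> P" for x y
        using that by (auto simp: P_def h.hom_add[symmetric] simp del: h.hom_add)
      show "r \<odot>\<^bsub>M\<^esub> x \<in> P" if "r \<in> carrier R" "x \<in> P" for r x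
        using that by (auto simp: P_def hD(3)[symmetric] T.lsmult_closed)
      show "x \<triangleleft>\<^bsub>M\<^esub> s \<in> P" if "x \<in> P" "s \<in> carrier S" for x s
        using that by (auto simp: P_def hD(4)[symmetric] T.rsmult_closed)
    qed
    have Q: "subbimodule Q R S M"
    proof (rule subbimoduleI[OF assms(2)])
      show "r \<odot>\<^bsub>M\<^esub> x \<in> Q" if "r \<in> carrier R" "x \<in> Q" for r x
        using that abelian_group_hom.hom_zero[OF T.lsmult_abelian_group_hom]
        by (auto simp: Q_def kD(3) M.lsmult_closed)
      show "x \<triangleleft>\<^bsub>M\<^esub> s \<in> Q" if "x \<in> Q" "s \<in> carrier S" for x s
        using that abelian_group_hom.hom_zero[OF T.rsmult_abelian_group_hom]
        by (auto simp: Q_def kD(4) M.rsmult_closed)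
    qed (auto simp: Q_def)
    have "P \<inter> Q = {\<zero>\<^bsub>M\<^esub>}"
      by (auto simp: P_def Q_def kh intro!: image_eqI[of _ _ "\<zero>\<^bsub>T\<^esub>"])
    moreover have "P <+>\<^bsub>M\<^esub> Q = carrier M"
    proof
      show "P <+>\<^bsub>M\<^esub> Q \<subseteq> carrier M"
        by (auto simp: set_add_def' P_def Q_def)
      show "carrier M \<subseteq> P <+>\<^bsub>M\<^esub> Q"
      proof
        fix m assume m: "m \<in> carrier M"
        then have "m = h (k m) \<oplus>\<^bsub>M\<^esub> (m \<ominus>\<^bsub>M\<^esub> h (k m))"
          by (simp add: M.M.add_minus_cancel_right)
        moreover have "m \<ominus>\<^bsub>M\<^esub> h (k m) \<in> Q"
          using m by (simp add: Q_def k.hom_minus kh T.M.minus_self)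
        ultimately show "m \<in> P <+>\<^bsub>M\<^esub> Q"
          using m by (auto simp: set_add_def' P_def)
      qed
    qed
    ultimately have "direct_summand P R S M"
      using P Q by (auto simp: direct_summand_def)
    moreover have "h \<in> bimodule_iso R S T (M\<lparr>carrier := P\<rparr>)"
      using hM kh inj_on_inverseI[of "carrier T" k h]
      by (simp add: bimodule_iso_def bimodule_hom_def P_def bij_betw_def Pi_iff)
    ultimately show ?L
      by blast
  }
qed

section \<open>Homomorphisms into and out of a finite power\<close>

lemma bimodule_power_simps [simp]:
  "carrier (bimodule_power M N) = {..<N} \<rightarrow>\<^sub>E carrier M"
  "\<zero>\<^bsub>bimodule_power M N\<^esub> = (\<lambda>i\<in>{..<N}. \<zero>\<^bsub>M\<^esub>)"
  "v \<oplus>\<^bsub>bimodule_power M N\<^esub> w = (\<lambda>i\<in>{..<N}. v i \<oplus>\<^bsub>M\<^esub> w i)"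
  "r \<odot>\<^bsub>bimodule_power M N\<^esub> v = (\<lambda>i\<in>{..<N}. r \<odot>\<^bsub>M\<^esub> v i)"
  "v \<triangleleft>\<^bsub>bimodule_power M N\<^esub> s = (\<lambda>i\<in>{..<N}. v i \<triangleleft>\<^bsub>M\<^esub> s)"
  by (simp_all add: bimodule_power_def)

lemma bimodule_hom_coordinate:
  "i < N \<Longrightarrow> (\<lambda>v. v i) \<in> bimodule_hom R S (bimodule_power M N) M"
  by (rule bimodule_homI) auto

lemma bimodule_hom_tuple:
  assumes "\<And>i. i < N \<Longrightarrow> h i \<in> bimodule_hom R S T M"
  shows "(\<lambda>t. \<lambda>i\<in>{..<N}. h i t) \<in> bimodule_hom R S T (bimodule_power M N)"
  using bimodule_homD[OF assms]
  by (intro bimodule_homI) (auto intro!: restrict_ext)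

definition power_inj :: "('r, 'm, 's, 'z) bimodule_scheme \<Rightarrow> nat \<Rightarrow> nat \<Rightarrow> 'm \<Rightarrow> nat \<Rightarrow> 'm"
  where "power_inj M N i x = (\<lambda>j\<in>{..<N}. if j = i then x else \<zero>\<^bsub>M\<^esub>)"

lemma bimodule_hom_power_inj:
  assumes "bimodule R S M"
  shows "power_inj M N i \<in> bimodule_hom R S M (bimodule_power M N)"
proof -
  interpret bimodule R S M by fact
  show ?thesis
    using abelian_group_hom.hom_zero[OF lsmult_abelian_group_hom]
      abelian_group_hom.hom_zero[OF rsmult_abelian_group_hom]
    by (intro bimodule_homI) (auto simp: power_inj_def intro!: restrict_ext)
qed

text \<open>A vector is the sum of its coordinates, each injected in its place. The sum never has to be formed
  inside the power: \<open>v\<close> is built up from zero one coordinate at a time, and \<open>k\<close> is additive.\<close>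

lemma bimodule_hom_power_decompose:
  assumes "bimodule R S M" "bimodule R S T" "k \<in> bimodule_hom R S (bimodule_power M N) T"
    and v: "v \<in> carrier (bimodule_power M N)"
  shows "k v = (\<Oplus>\<^bsub>T\<^esub>i\<in>{..<N}. k (power_inj M N i (v i)))"
proof -
  interpret M: bimodule R S M by fact
  interpret T: bimodule R S T by fact
  interpret k: abelian_group_hom "bimodule_power M N" T k
    using bimodule_hom_abelian_group_hom[OF bimodule_power_bimodule[OF assms(1)] assms(2,3)] .
  have vi: "v i \<in> carrier M" if "i < N" for i
    using v that by auto
  have inj: "power_inj M N i (v i) \<in> carrier (bimodule_power M N)" if "i < N" for i
    using vi[OF that] by (auto simp: power_inj_def)
  define w where "w n = (\<lambda>j\<in>{..<N}. if j < n then v j else \<zero>\<^bsub>M\<^esub>)" for n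
  have "k (w n) = (\<Oplus>\<^bsub>T\<^esub>i\<in>{..<n}. k (power_inj M N i (v i)))" if "n \<le> N" for n
    using that
  proof (induction n)
    case 0
    have "w 0 = \<zero>\<^bsub>bimodule_power M N\<^esub>" by (simp add: w_def)
    then have "k (w 0) = \<zero>\<^bsub>T\<^esub>" by (rule ssubst) (rule k.hom_zero)
    then show ?case by simp
  next
    case (Suc n)
    have wn: "w n \<in> carrier (bimodule_power M N)" using vi by (auto simp: w_def)
    have "w (Suc n) = power_inj M N n (v n) \<oplus>\<^bsub>bimodule_power M N\<^esub> w n"
      using vi Suc.prems by (auto simp: w_def power_inj_def fun_eq_iff less_Suc_eq)
    then have "k (w (Suc n)) = k (power_inj M N n (v n)) \<oplus>\<^bsub>T\<^esub> k (w n)"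
      using k.hom_add[OF inj wn] Suc.prems by simp
    moreover have "(\<lambda>i. k (power_inj M N i (v i))) \<in> {..<n} \<rightarrow> carrier T"
      "k (power_inj M N n (v n)) \<in> carrier T"
      using Suc.prems k.hom_closed[OF inj] by auto
    ultimately show ?case
      using Suc by (simp add: lessThan_Suc)
  qed
  moreover have "w N = v"
    using v by (auto simp: w_def fun_eq_iff PiE_iff extensional_def)
  ultimately show ?thesis by (metis order_refl)
qed

lemma bimodule_hom_cotuple:
  assumes "bimodule R S T" "\<And>i. i < N \<Longrightarrow> k i \<in> bimodule_hom R S M T"
  shows "(\<lambda>v. \<Oplus>\<^bsub>T\<^esub>i\<in>{..<N}. k i (v i)) \<in> bimodule_hom R S (bimodule_power M N) T"
proof -
  interpret T: bimodule R S T by fact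
  note D = bimodule_homD[OF assms(2)]
  have c: "(\<lambda>i. k i (v i)) \<in> {..<N} \<rightarrow> carrier T" if "v \<in> carrier (bimodule_power M N)" for v
    using that by (auto intro!: D)
  show ?thesis
  proof (rule bimodule_homI)
    fix x assume "x \<in> carrier (bimodule_power M N)"
    then show "(\<Oplus>\<^bsub>T\<^esub>i\<in>{..<N}. k i (x i)) \<in> carrier T"
      by (intro T.M.finsum_closed c)
  next
    fix x y assume xy: "x \<in> carrier (bimodule_power M N)" "y \<in> carrier (bimodule_power M N)"
    have "(\<Oplus>\<^bsub>T\<^esub>i\<in>{..<N}. k i ((x \<oplus>\<^bsub>bimodule_power M N\<^esub> y) i))
        = (\<Oplus>\<^bsub>T\<^esub>i\<in>{..<N}. k i (x i) \<oplus>\<^bsub>T\<^esub> k i (y i))"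
      using xy by (intro T.M.finsum_cong') (auto intro!: D)
    also have "\<dots> = (\<Oplus>\<^bsub>T\<^esub>i\<in>{..<N}. k i (x i)) \<oplus>\<^bsub>T\<^esub> (\<Oplus>\<^bsub>T\<^esub>i\<in>{..<N}. k i (y i))"
      by (intro T.M.finsum_addf c xy)
    finally show "(\<Oplus>\<^bsub>T\<^esub>i\<in>{..<N}. k i ((x \<oplus>\<^bsub>bimodule_power M N\<^esub> y) i))
        = (\<Oplus>\<^bsub>T\<^esub>i\<in>{..<N}. k i (x i)) \<oplus>\<^bsub>T\<^esub> (\<Oplus>\<^bsub>T\<^esub>i\<in>{..<N}. k i (y i))" .
  next
    fix r x assume x: "r \<in> carrier R" "x \<in> carrier (bimodule_power M N)"
    have "(\<Oplus>\<^bsub>T\<^esub>i\<in>{..<N}. k i ((r \<odot>\<^bsub>bimodule_power M N\<^esub> x) i))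
        = (\<Oplus>\<^bsub>T\<^esub>i\<in>{..<N}. r \<odot>\<^bsub>T\<^esub> k i (x i))"
      using x by (intro T.M.finsum_cong') (auto intro!: D T.lsmult_closed)
    also have "\<dots> = r \<odot>\<^bsub>T\<^esub> (\<Oplus>\<^bsub>T\<^esub>i\<in>{..<N}. k i (x i))"
      using abelian_group_hom.hom_finsum[OF T.lsmult_abelian_group_hom[OF x(1)] c[OF x(2)]] by simp
    finally show "(\<Oplus>\<^bsub>T\<^esub>i\<in>{..<N}. k i ((r \<odot>\<^bsub>bimodule_power M N\<^esub> x) i))
        = r \<odot>\<^bsub>T\<^esub> (\<Oplus>\<^bsub>T\<^esub>i\<in>{..<N}. k i (x i))" .
  next
    fix x s assume x: "x \<in> carrier (bimodule_power M N)" "s \<in> carrier S"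
    have "(\<Oplus>\<^bsub>T\<^esub>i\<in>{..<N}. k i ((x \<triangleleft>\<^bsub>bimodule_power M N\<^esub> s) i))
        = (\<Oplus>\<^bsub>T\<^esub>i\<in>{..<N}. k i (x i) \<triangleleft>\<^bsub>T\<^esub> s)"
      using x by (intro T.M.finsum_cong') (auto intro!: D T.rsmult_closed)
    also have "\<dots> = (\<Oplus>\<^bsub>T\<^esub>i\<in>{..<N}. k i (x i)) \<triangleleft>\<^bsub>T\<^esub> s"
      using abelian_group_hom.hom_finsum[OF T.rsmult_abelian_group_hom[OF x(2)] c[OF x(1)]] by simp
    finally show "(\<Oplus>\<^bsub>T\<^esub>i\<in>{..<N}. k i ((x \<triangleleft>\<^bsub>bimodule_power M N\<^esub> s) i))
        = (\<Oplus>\<^bsub>T\<^esub>i\<in>{..<N}. k i (x i)) \<triangleleft>\<^bsub>T\<^esub> s" .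
  qed
qed

text \<open>Homomorphisms into and out of \<open>M\<^sup>N\<close> are families of coordinate homomorphisms, and composing
  them means summing the composites.\<close>

lemma retract_of_power_iff:
  assumes "bimodule R S T" "bimodule R S M"
  shows "(\<exists>h\<in>bimodule_hom R S T (bimodule_power M N). \<exists>k\<in>bimodule_hom R S (bimodule_power M N) T.
      \<forall>t\<in>carrier T. k (h t) = t) \<longleftrightarrow>
    (\<exists>h k. (\<forall>i<N. h i \<in> bimodule_hom R S T M) \<and> (\<forall>i<N. k i \<in> bimodule_hom R S M T) \<and>
      (\<forall>t\<in>carrier T. t = (\<Oplus>\<^bsub>T\<^esub>i\<in>{..<N}. k i (h i t))))"
    (is "?L \<longleftrightarrow> ?R")
proof
  interpret T: bimodule R S T by fact
  {
    assume ?L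
    then obtain h k where h: "h \<in> bimodule_hom R S T (bimodule_power M N)"
      and k: "k \<in> bimodule_hom R S (bimodule_power M N) T"
      and kh: "\<And>t. t \<in> carrier T \<Longrightarrow> k (h t) = t"
      by blast
    have "(\<lambda>t. h t i) \<in> bimodule_hom R S T M" if "i < N" for i
      using bimodule_hom_comp[OF h bimodule_hom_coordinate[OF that]] .
    moreover have "(\<lambda>x. k (power_inj M N i x)) \<in> bimodule_hom R S M T" for i
      using bimodule_hom_comp[OF bimodule_hom_power_inj[OF assms(2)] k] .
    moreover have "t = (\<Oplus>\<^bsub>T\<^esub>i\<in>{..<N}. k (power_inj M N i (h t i)))" if "t \<in> carrier T" for t
      using bimodule_hom_power_decompose[OF assms(2,1) k bimodule_homD(1)[OF h that]] kh[OF that]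
      by simp
    ultimately show ?R
      by (intro exI[of _ "\<lambda>i t. h t i"] exI[of _ "\<lambda>i x. k (power_inj M N i x)"]) blast
  next
    assume ?R
    then obtain h k where h: "\<And>i. i < N \<Longrightarrow> h i \<in> bimodule_hom R S T M"
      and k: "\<And>i. i < N \<Longrightarrow> k i \<in> bimodule_hom R S M T"
      and kh: "\<And>t. t \<in> carrier T \<Longrightarrow> t = (\<Oplus>\<^bsub>T\<^esub>i\<in>{..<N}. k i (h i t))"
      by blast
    have "(\<Oplus>\<^bsub>T\<^esub>i\<in>{..<N}. k i ((\<lambda>i\<in>{..<N}. h i t) i)) = t" if t: "t \<in> carrier T" for t
    proof -
      have "(\<Oplus>\<^bsub>T\<^esub>i\<in>{..<N}. k i ((\<lambda>i\<in>{..<N}. h i t) i)) = (\<Oplus>\<^bsub>T\<^esub>i\<in>{..<N}. k i (h i t))"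
        using t by (intro T.M.finsum_cong') (auto intro!: bimodule_homD[OF h] bimodule_homD[OF k])
      then show ?thesis using kh[OF t] by simp
    qed
    then have "\<exists>k\<in>bimodule_hom R S (bimodule_power M N) T. \<forall>t\<in>carrier T. k (\<lambda>i\<in>{..<N}. h i t) = t"
      by (intro bexI[OF _ bimodule_hom_cotuple[of R S T N k M, OF assms(1) k]] ballI)
    then show ?L
      by (rule bexI[OF _ bimodule_hom_tuple[of N h, OF h]])
  }
qed

section \<open>The universal property of the tensor product\<close>

context bimodule_pair
begin

abbreviation "MT \<equiv> tensor_product S M L"
abbreviation "pure \<equiv> pure_tensor S M L"

lemma pure_closed: "\<lbrakk>x \<in> carrier M; y \<in> carrier L\<rbrakk> \<Longrightarrow> pure x y \<in> carrier MT"
  by (simp add: carrier_tensor pure_tensor_def)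

lemma lsmult_pure: "r \<in> carrier R \<Longrightarrow> r \<odot>\<^bsub>MT\<^esub> pure x y = pure (r \<odot>\<^bsub>M\<^esub> x) y"
  by (simp add: pure_tensor_def smult_cls)

lemma rsmult_pure: "t \<in> carrier T \<Longrightarrow> pure x y \<triangleleft>\<^bsub>MT\<^esub> t = pure x (y \<triangleleft>\<^bsub>L\<^esub> t)"
  by (simp add: pure_tensor_def rsmult_cls)

lemma pure_add_right:
  assumes "x \<in> carrier M" "y \<in> carrier L" "y' \<in> carrier L"
  shows "pure x (y \<oplus>\<^bsub>L\<^esub> y') = pure x y \<oplus>\<^bsub>MT\<^esub> pure x y'"
proof -
  have "frag_of (x, y) \<in> carrier F" "frag_of (x, y') \<in> carrier F"
    using assms by auto
  then show ?thesis
    using rel2[OF assms]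
    by (simp add: pure_tensor_def add_cls cls_eq diff_diff_eq del: carrier_free_Abelian_group_iff)
qed

lemma pure_balanced:
  "\<lbrakk>x \<in> carrier M; s \<in> carrier S; y \<in> carrier L\<rbrakk> \<Longrightarrow> pure (x \<triangleleft>\<^bsub>M\<^esub> s) y = pure x (s \<odot>\<^bsub>L\<^esub> y)"
  using rel3 by (simp add: pure_tensor_def cls_eq)

text \<open>Closure under differences suffices because pure tensors generate the tensor product as an
  additive group.\<close>

lemma tensor_induct [consumes 1, case_names zero minus pure]:
  assumes "m \<in> carrier MT" and zero: "P \<zero>\<^bsub>MT\<^esub>"
    and minus: "\<And>a b. \<lbrakk>a \<in> carrier MT; b \<in> carrier MT; P a; P b\<rbrakk> \<Longrightarrow> P (a \<ominus>\<^bsub>MT\<^esub> b)"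
    and pure: "\<And>x y. \<lbrakk>x \<in> carrier M; y \<in> carrier L\<rbrakk> \<Longrightarrow> P (pure x y)"
  shows "P m"
proof -
  interpret MT: bimodule R T MT by (rule tensor_bimodule)
  obtain c where c: "c \<in> carrier F" "m = cls c"
    using assms(1) by (auto simp: carrier_tensor)
  have "P (cls c)"
  proof (rule free_Abelian_group_induct[where P = "\<lambda>c. P (cls c)"])
    show "Poly_Mapping.keys c \<subseteq> carrier M \<times> carrier L" using c by simp
    show "P (cls 0)" using zero by (simp add: zero_tensor)
    show "P (cls (frag_of a))" if "a \<in> carrier M \<times> carrier L" for a
      using that pure by (auto simp: pure_tensor_def)
  next
    fix x y
    assume xy: "Poly_Mapping.keys x \<subseteq> carrier M \<times> carrier L"
      "Poly_Mapping.keys y \<subseteq> carrier M \<times> carrier L" and P: "P (cls x)" "P (cls y)"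
    then have F: "x \<in> carrier F" "y \<in> carrier F" "x - y \<in> carrier F"
      using keys_diff[of x y] by auto
    then have C: "cls x \<in> carrier MT" "cls y \<in> carrier MT" "cls (x - y) \<in> carrier MT"
      by (simp_all add: carrier_tensor del: carrier_free_Abelian_group_iff)
    have "cls (x - y) \<oplus>\<^bsub>MT\<^esub> cls y = cls x"
      using F by (simp add: add_cls del: carrier_free_Abelian_group_iff)
    then have "cls (x - y) = cls x \<ominus>\<^bsub>MT\<^esub> cls y"
      using C by (metis MT.M.add.inv_closed MT.M.a_assoc MT.M.r_neg MT.M.r_zero a_minus_def a_inv_def)
    then show "P (cls (x - y))"
      using minus C P by simp
  qed
  then show ?thesis using c by simp
qed

lemma bimodule_hom_eqI_pure:
  assumes "bimodule R T D" "h \<in> bimodule_hom R T MT D" "k \<in> bimodule_hom R T MT D"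
    and "\<And>x y. \<lbrakk>x \<in> carrier M; y \<in> carrier L\<rbrakk> \<Longrightarrow> h (pure x y) = k (pure x y)"
    and "m \<in> carrier MT"
  shows "h m = k m"
proof -
  interpret h: abelian_group_hom MT D h
    using bimodule_hom_abelian_group_hom[OF tensor_bimodule assms(1,2)] .
  interpret k: abelian_group_hom MT D k
    using bimodule_hom_abelian_group_hom[OF tensor_bimodule assms(1,3)] .
  show ?thesis
    using assms(5) by (induction rule: tensor_induct) (simp_all add: h.hom_minus k.hom_minus assms(4))
qed

text \<open>The conditions on \<open>\<phi>\<close> say that its additive extension to the free abelian group vanishes on the
  relations defining the tensor product, so it factors through the quotient; compatibility with the
  actions is inherited from pure tensors.\<close>

lemma tensor_lift:
  assumes "bimodule R T D"
    and cl: "\<And>x y. \<lbrakk>x \<in> carrier M; y \<in> carrier L\<rbrakk> \<Longrightarrow> \<phi> x y \<in> carrier D"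
    and add_l: "\<And>x x' y. \<lbrakk>x \<in> carrier M; x' \<in> carrier M; y \<in> carrier L\<rbrakk>
      \<Longrightarrow> \<phi> (x \<oplus>\<^bsub>M\<^esub> x') y = \<phi> x y \<oplus>\<^bsub>D\<^esub> \<phi> x' y"
    and add_r: "\<And>x y y'. \<lbrakk>x \<in> carrier M; y \<in> carrier L; y' \<in> carrier L\<rbrakk>
      \<Longrightarrow> \<phi> x (y \<oplus>\<^bsub>L\<^esub> y') = \<phi> x y \<oplus>\<^bsub>D\<^esub> \<phi> x y'"
    and balanced: "\<And>x s y. \<lbrakk>x \<in> carrier M; s \<in> carrier S; y \<in> carrier L\<rbrakk>
      \<Longrightarrow> \<phi> (x \<triangleleft>\<^bsub>M\<^esub> s) y = \<phi> x (s \<odot>\<^bsub>L\<^esub> y)"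
    and left: "\<And>r x y. \<lbrakk>r \<in> carrier R; x \<in> carrier M; y \<in> carrier L\<rbrakk>
      \<Longrightarrow> \<phi> (r \<odot>\<^bsub>M\<^esub> x) y = r \<odot>\<^bsub>D\<^esub> \<phi> x y"
    and right: "\<And>x y t. \<lbrakk>x \<in> carrier M; y \<in> carrier L; t \<in> carrier T\<rbrakk>
      \<Longrightarrow> \<phi> x (y \<triangleleft>\<^bsub>L\<^esub> t) = \<phi> x y \<triangleleft>\<^bsub>D\<^esub> t"
  obtains h where "h \<in> bimodule_hom R T MT D"
    "\<And>x y. \<lbrakk>x \<in> carrier M; y \<in> carrier L\<rbrakk> \<Longrightarrow> h (pure x y) = \<phi> x y"
proof -
  interpret D: bimodule R T D by fact
  interpret MT: bimodule R T MT by (rule tensor_bimodule)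
  have "(\<lambda>(x, y). \<phi> x y) ` (carrier M \<times> carrier L) \<subseteq> carrier (add_monoid D)"
    using cl by auto
  then obtain H where H: "H \<in> hom F (add_monoid D)"
    and H_of: "\<And>z. z \<in> carrier M \<times> carrier L \<Longrightarrow> H (frag_of z) = (\<lambda>(x, y). \<phi> x y) z"
    using comm_group.free_Abelian_group_universal[OF D.M.a_comm_group] by blast
  interpret H: group_hom F "add_monoid D" H
    using H by (intro group_hom.intro group_hom_axioms.intro) (simp_all add: D.M.a_group)
  have F_minus: "a - b \<in> carrier F" if "a \<in> carrier F" "b \<in> carrier F" for a b
    using that keys_diff[of a b] by auto
  have H_minus: "H (a - b) = H a \<ominus>\<^bsub>D\<^esub> H b" if "a \<in> carrier F" "b \<in> carrier F" for a b
  proof -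
    have Hab: "H (a - b) \<in> carrier D" "H b \<in> carrier D"
      using H.hom_closed[OF F_minus[OF that]] H.hom_closed[OF that(2)] by simp_all
    have "H a = H b \<oplus>\<^bsub>D\<^esub> H (a - b)"
      using H.hom_mult[OF that(2) F_minus[OF that]] by simp
    then show ?thesis
      using D.M.add_minus_cancel_left[OF Hab(2,1)] by simp
  qed
  have of_F: "frag_of (x, y) \<in> carrier F" if "x \<in> carrier M" "y \<in> carrier L" for x y
    using that by simp
  \<comment> \<open>the shape in which \<open>H\<close> maps the two additivity relations\<close>
  have sub3: "(a \<oplus>\<^bsub>D\<^esub> b) \<ominus>\<^bsub>D\<^esub> a \<ominus>\<^bsub>D\<^esub> b = \<zero>\<^bsub>D\<^esub>" if "a \<in> carrier D" "b \<in> carrier D" for a b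
    using that by (simp add: D.M.add_minus_cancel_left D.M.minus_self)
  have "H a = \<zero>\<^bsub>D\<^esub>" if "a \<in> tensor_relations S M L" for a
    using that unfolding tensor_relations_def
    by (auto simp: H_minus F_minus of_F H_of cl add_l add_r balanced sub3 D.M.minus_self M.rsmult_closed L.lsmult_closed
        simp del: carrier_free_Abelian_group_iff)
  then have "tensor_relations S M L \<subseteq> kernel F (add_monoid D) H"
    using rel_carrier by (auto simp: kernel_def simp del: carrier_free_Abelian_group_iff)
  then have "K \<subseteq> kernel F (add_monoid D) H"
    unfolding tensor_kernel_def
    by (rule H.G.generate_subgroup_incl[OF _ H.subgroup_kernel])
  then obtain h where h: "h \<in> hom (F Mod K) (add_monoid D)"
    and h_cls: "\<And>c. c \<in> carrier F \<Longrightarrow> h (cls c) = H c"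
    using H.FactGroup_universal_kernel[OF K_normal] unfolding tensor_class_def by metis
  have hp: "h (pure x y) = \<phi> x y" if "x \<in> carrier M" "y \<in> carrier L" for x y
    using that by (simp add: pure_tensor_def h_cls H_of)
  have hc: "h m \<in> carrier D" if "m \<in> carrier MT" for m
    using h that by (auto simp: tensor_product_def Let_def hom_def)
  have hadd: "h (a \<oplus>\<^bsub>MT\<^esub> b) = h a \<oplus>\<^bsub>D\<^esub> h b" if "a \<in> carrier MT" "b \<in> carrier MT" for a b
    using h that by (auto simp: tensor_product_def Let_def hom_def)
  interpret h: abelian_group_hom MT D h
    by (rule additive_abelian_group_hom[OF MT.M.abelian_group_axioms D.M.abelian_group_axioms hc hadd])
  have "h \<in> bimodule_hom R T MT D"
  proof (rule bimodule_homI[OF hc hadd])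
    fix r m assume r: "r \<in> carrier R" and m: "m \<in> carrier MT"
    interpret l: abelian_group_hom MT MT "\<lambda>x. r \<odot>\<^bsub>MT\<^esub> x" using MT.lsmult_abelian_group_hom[OF r] .
    interpret l': abelian_group_hom D D "\<lambda>x. r \<odot>\<^bsub>D\<^esub> x" using D.lsmult_abelian_group_hom[OF r] .
    show "h (r \<odot>\<^bsub>MT\<^esub> m) = r \<odot>\<^bsub>D\<^esub> h m"
      using m
    proof (induction rule: tensor_induct)
      case (pure x y)
      then show ?case using r by (simp add: lsmult_pure hp left M.lsmult_closed)
    qed (simp_all add: h.hom_minus l.hom_minus l'.hom_minus)
  next
    fix m t assume m: "m \<in> carrier MT" and t: "t \<in> carrier T"
    interpret l: abelian_group_hom MT MT "\<lambda>x. x \<triangleleft>\<^bsub>MT\<^esub> t" using MT.rsmult_abelian_group_hom[OF t] .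
    interpret l': abelian_group_hom D D "\<lambda>x. x \<triangleleft>\<^bsub>D\<^esub> t" using D.rsmult_abelian_group_hom[OF t] .
    show "h (m \<triangleleft>\<^bsub>MT\<^esub> t) = h m \<triangleleft>\<^bsub>D\<^esub> t"
      using m
    proof (induction rule: tensor_induct)
      case (pure x y)
      then show ?case using t by (simp add: rsmult_pure hp right L.rsmult_closed)
    qed (simp_all add: h.hom_minus l.hom_minus l'.hom_minus)
  qed
  then show thesis using hp that by blast
qed

end

section \<open>Depth three towers\<close>

context ring_tower
begin

abbreviation "AA \<equiv> tower_tensor A B g f"
abbreviation "A_AC \<equiv> ring_bimodule A id (g \<circ> f)"
abbreviation "tens \<equiv> tower_pure_tensor A B g f"

sublocale tensor: bimodule_pair A B C "ring_bimodule A id g" "ring_bimodule A g (g \<circ> f)"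
  rewrites "tensor_product B (ring_bimodule A id g) (ring_bimodule A g (g \<circ> f)) = AA"
    and "pure_tensor B (ring_bimodule A id g) (ring_bimodule A g (g \<circ> f)) = tens"
proof -
  have "id \<in> ring_hom A A"
    by (simp add: ring_hom_def)
  then show "bimodule_pair A B C (ring_bimodule A id g) (ring_bimodule A g (g \<circ> f))"
    by (intro bimodule_pair.intro ring_bimodule_bimodule A.ring_axioms B.ring_axioms C.ring_axioms
        hom_BA ring_hom_trans[OF hom_CB hom_BA])
qed (simp_all add: tower_tensor_def tower_pure_tensor_def)

sublocale AA: bimodule A C AA
  by (rule tower_tensor_bimodule)

lemma A_AC_bimodule: "bimodule A C A_AC"
  by (intro ring_bimodule_bimodule A.ring_axioms C.ring_axioms ring_hom_trans[OF hom_CB hom_BA])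
    (simp add: ring_hom_def)

lemma ring_bimodule_simps [simp]:
  "carrier (ring_bimodule A \<phi> \<psi>) = carrier A"
  "x \<oplus>\<^bsub>ring_bimodule A \<phi> \<psi>\<^esub> y = x \<oplus>\<^bsub>A\<^esub> y"
  "r \<odot>\<^bsub>ring_bimodule A \<phi> \<psi>\<^esub> x = \<phi> r \<otimes>\<^bsub>A\<^esub> x"
  "x \<triangleleft>\<^bsub>ring_bimodule A \<phi> \<psi>\<^esub> s = x \<otimes>\<^bsub>A\<^esub> \<psi> s"
  by (simp_all add: ring_bimodule_def)

lemma g_closed: "b \<in> carrier B \<Longrightarrow> g b \<in> carrier A"
  using hom_BA by (rule ring_hom_closed)

lemma gf_closed: "c \<in> carrier C \<Longrightarrow> g (f c) \<in> carrier A"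
  using hom_CB by (intro g_closed) (rule ring_hom_closed)

lemma tower_End_closed: "\<lbrakk>\<gamma> \<in> tower_End A B C g f; y \<in> carrier A\<rbrakk> \<Longrightarrow> \<gamma> y \<in> carrier A"
  unfolding tower_End_def by (drule bimodule_homD(1)) auto

lemma lsmult_tens:
  "r \<in> carrier A \<Longrightarrow> r \<odot>\<^bsub>AA\<^esub> tens x y = tens (r \<otimes>\<^bsub>A\<^esub> x) y"
  using tensor.lsmult_pure by simp

text \<open>Left \<open>B\<close>-linearity of \<open>y \<mapsto> h (1 \<otimes> y)\<close> holds because an element of \<open>B\<close> can be moved across the
  tensor sign and then out on the left: \<open>1 \<otimes> b y = b \<otimes> y = b (1 \<otimes> y)\<close>.\<close>

lemma hom_to_ring_imp_tower_End:
  assumes "h \<in> bimodule_hom A C AA A_AC"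
  shows "(\<lambda>y. h (tens \<one>\<^bsub>A\<^esub> y)) \<in> tower_End A B C g f"
  unfolding tower_End_def
proof (rule bimodule_homI)
  note D = bimodule_homD[OF assms]
  have tc: "tens x y \<in> carrier AA" if "x \<in> carrier A" "y \<in> carrier A" for x y
    using tensor.pure_closed that by simp
  show "h (tens \<one>\<^bsub>A\<^esub> y) \<in> carrier (ring_bimodule A g (g \<circ> f))"
    if "y \<in> carrier (ring_bimodule A g (g \<circ> f))" for y
    using that D(1) tc by simp
  show "h (tens \<one>\<^bsub>A\<^esub> (x \<oplus>\<^bsub>ring_bimodule A g (g \<circ> f)\<^esub> y)) =
      h (tens \<one>\<^bsub>A\<^esub> x) \<oplus>\<^bsub>ring_bimodule A g (g \<circ> f)\<^esub> h (tens \<one>\<^bsub>A\<^esub> y)"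
    if "x \<in> carrier (ring_bimodule A g (g \<circ> f))" "y \<in> carrier (ring_bimodule A g (g \<circ> f))" for x y
    using that D(2) tc tensor.pure_add_right[of "\<one>\<^bsub>A\<^esub>" x y] by simp
  show "h (tens \<one>\<^bsub>A\<^esub> (b \<odot>\<^bsub>ring_bimodule A g (g \<circ> f)\<^esub> y)) =
      b \<odot>\<^bsub>ring_bimodule A g (g \<circ> f)\<^esub> h (tens \<one>\<^bsub>A\<^esub> y)"
    if "b \<in> carrier B" "y \<in> carrier (ring_bimodule A g (g \<circ> f))" for b y
  proof -
    have "tens \<one>\<^bsub>A\<^esub> (g b \<otimes>\<^bsub>A\<^esub> y) = g b \<odot>\<^bsub>AA\<^esub> tens \<one>\<^bsub>A\<^esub> y"
      using that tensor.pure_balanced[of "\<one>\<^bsub>A\<^esub>" b y] by (simp add: g_closed lsmult_tens)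
    then show ?thesis
      using that D(3)[of "g b"] tc by (simp add: g_closed)
  qed
  show "h (tens \<one>\<^bsub>A\<^esub> (y \<triangleleft>\<^bsub>ring_bimodule A g (g \<circ> f)\<^esub> c)) =
      h (tens \<one>\<^bsub>A\<^esub> y) \<triangleleft>\<^bsub>ring_bimodule A g (g \<circ> f)\<^esub> c"
    if "y \<in> carrier (ring_bimodule A g (g \<circ> f))" "c \<in> carrier C" for y c
    using that D(4)[OF tc, of "\<one>\<^bsub>A\<^esub>" y c] tensor.rsmult_pure[of c "\<one>\<^bsub>A\<^esub>" y] by simp
qed

lemma hom_to_ring_tens:
  assumes "h \<in> bimodule_hom A C AA A_AC" "x \<in> carrier A" "y \<in> carrier A"
  shows "h (tens x y) = x \<otimes>\<^bsub>A\<^esub> h (tens \<one>\<^bsub>A\<^esub> y)"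
  using bimodule_homD(3)[OF assms(1), of x "tens \<one>\<^bsub>A\<^esub> y"] tensor.pure_closed[of "\<one>\<^bsub>A\<^esub>" y] assms
  by (simp add: lsmult_tens)

text \<open>Left \<open>B\<close>-linearity of \<open>\<gamma>\<close> is what makes \<open>(x, y) \<mapsto> x \<gamma>(y)\<close> balanced over \<open>B\<close>.\<close>

lemma tower_End_imp_hom_to_ring:
  assumes "\<gamma> \<in> tower_End A B C g f"
  obtains h where "h \<in> bimodule_hom A C AA A_AC"
    "\<And>x y. \<lbrakk>x \<in> carrier A; y \<in> carrier A\<rbrakk> \<Longrightarrow> h (tens x y) = x \<otimes>\<^bsub>A\<^esub> \<gamma> y"
proof -
  note D = bimodule_homD[OF assms[unfolded tower_End_def], simplified]
  show thesis
    by (rule tensor.tensor_lift[OF A_AC_bimodule, of "\<lambda>x y. x \<otimes>\<^bsub>A\<^esub> \<gamma> y"])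
      (auto simp: D g_closed gf_closed A.l_distr A.r_distr A.m_assoc intro: that)
qed

text \<open>In \<open>A\<close>, the element \<open>c\<close> acts on \<open>1\<close> in the same way from both sides, so \<open>k 1\<close> commutes with \<open>c\<close>.\<close>

lemma hom_from_ring_imp_centralizer:
  assumes "k \<in> bimodule_hom A C A_AC AA"
  shows "k \<one>\<^bsub>A\<^esub> \<in> tower_tensor_centralizer A B C g f"
    and "a \<in> carrier A \<Longrightarrow> k a = a \<odot>\<^bsub>AA\<^esub> k \<one>\<^bsub>A\<^esub>"
proof -
  note D = bimodule_homD[OF assms, simplified]
  show "k a = a \<odot>\<^bsub>AA\<^esub> k \<one>\<^bsub>A\<^esub>" if "a \<in> carrier A" for a
    using D(3)[OF that A.one_closed] that by simp
  show "k \<one>\<^bsub>A\<^esub> \<in> tower_tensor_centralizer A B C g f"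
    using D(1)[of "\<one>\<^bsub>A\<^esub>"] D(3)[OF gf_closed A.one_closed] D(4)[of "\<one>\<^bsub>A\<^esub>"]
    by (simp add: tower_tensor_centralizer_def gf_closed)
qed

lemma centralizer_imp_hom_from_ring:
  assumes "u \<in> tower_tensor_centralizer A B C g f"
  shows "(\<lambda>a. a \<odot>\<^bsub>AA\<^esub> u) \<in> bimodule_hom A C A_AC AA"
  using assms
  by (intro bimodule_homI)
    (auto simp: tower_tensor_centralizer_def AA.lsmult_closed AA.lsmult_l_distr AA.lsmult_assoc
      AA.lsmult_rsmult gf_closed)

lemma right_depth_three_iff_homs:
  "right_depth_three A B C g f \<longleftrightarrow>
    (\<exists>(N::nat)>0. \<exists>h k. (\<forall>i<N. h i \<in> bimodule_hom A C AA A_AC) \<and>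
      (\<forall>i<N. k i \<in> bimodule_hom A C A_AC AA) \<and>
      (\<forall>t\<in>carrier AA. t = (\<Oplus>\<^bsub>AA\<^esub>i\<in>{..<N}. k i (h i t))))"
  unfolding right_depth_three_def Let_def
    iso_direct_summand_iff_retract[OF tower_tensor_bimodule bimodule_power_bimodule[OF A_AC_bimodule]]
    retract_of_power_iff[OF tower_tensor_bimodule A_AC_bimodule]
  by (rule refl)

text \<open>The sum of the composites is a bimodule homomorphism because it factors through \<open>A\<^sup>N\<close>; it
  therefore agrees with the identity as soon as it does so on pure tensors.\<close>

lemma sum_hom_eq_id_iff:
  fixes N :: nat
  assumes "\<And>i. i < N \<Longrightarrow> h i \<in> bimodule_hom A C AA A_AC"
    and "\<And>i. i < N \<Longrightarrow> k i \<in> bimodule_hom A C A_AC AA"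
  shows "(\<forall>t\<in>carrier AA. t = (\<Oplus>\<^bsub>AA\<^esub>i\<in>{..<N}. k i (h i t))) \<longleftrightarrow>
    (\<forall>x\<in>carrier A. \<forall>y\<in>carrier A. tens x y = (\<Oplus>\<^bsub>AA\<^esub>i\<in>{..<N}. k i (h i (tens x y))))"
    (is "?L \<longleftrightarrow> ?R")
proof
  assume ?L
  then show ?R using tensor.pure_closed by simp
next
  assume R: ?R
  have sum: "(\<lambda>t. \<Oplus>\<^bsub>AA\<^esub>i\<in>{..<N}. k i ((\<lambda>i\<in>{..<N}. h i t) i)) \<in> bimodule_hom A C AA AA"
    by (rule bimodule_hom_comp[OF bimodule_hom_tuple[of N h] bimodule_hom_cotuple])
      (use assms tower_tensor_bimodule in auto)
  have c: "(\<Oplus>\<^bsub>AA\<^esub>i\<in>{..<N}. k i ((\<lambda>i\<in>{..<N}. h i t) i)) = (\<Oplus>\<^bsub>AA\<^esub>i\<in>{..<N}. k i (h i t))"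
    if "t \<in> carrier AA" for t
    using that by (intro AA.M.finsum_cong') (auto intro!: bimodule_homD(1)[OF assms(1)] bimodule_homD(1)[OF assms(2)])
  have id: "(\<lambda>t. t) \<in> bimodule_hom A C AA AA"
    by (rule bimodule_homI) auto
  show ?L
    using tensor.bimodule_hom_eqI_pure[OF tower_tensor_bimodule id sum] R c tensor.pure_closed by simp
qed

lemma sum_shift:
  assumes "\<And>i. i < N \<Longrightarrow> F (Suc i) \<in> carrier AA"
  shows "(\<Oplus>\<^bsub>AA\<^esub>i\<in>{1..N}. F i) = (\<Oplus>\<^bsub>AA\<^esub>i\<in>{..<N}. F (Suc i))"
proof -
  have "{1..N} = Suc ` {..<N}"
    by (simp add: image_Suc_lessThan)
  then show ?thesis
    using AA.M.finsum_reindex[of F Suc "{..<N}"] assms by auto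
qed

end

theorem theorem2p6:
  fixes A :: "('a, 'x) ring_scheme" and B :: "('b, 'y) ring_scheme" and C :: "('c, 'z) ring_scheme"
    and g :: "'b \<Rightarrow> 'a" and f :: "'c \<Rightarrow> 'b"
  assumes "ring_tower A B C g f"
  shows "right_depth_three A B C g f \<longleftrightarrow>
    (\<exists>(N::nat)>0. \<exists>\<gamma> :: nat \<Rightarrow> 'a \<Rightarrow> 'a. \<exists>u :: nat \<Rightarrow> ('a \<times> 'a \<Rightarrow>\<^sub>0 int) set.
       (\<forall>i\<in>{1..N}. \<gamma> i \<in> tower_End A B C g f) \<and>
       (\<forall>i\<in>{1..N}. u i \<in> tower_tensor_centralizer A B C g f) \<and>
       (\<forall>x\<in>carrier A. \<forall>y\<in>carrier A.
          tower_pure_tensor A B g f x y =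
          (\<Oplus>\<^bsub>tower_tensor A B g f\<^esub>i\<in>{1..N}. (x \<otimes>\<^bsub>A\<^esub> \<gamma> i y) \<odot>\<^bsub>tower_tensor A B g f\<^esub> u i)))"
    (is "?D \<longleftrightarrow> ?Q")
proof
  interpret ring_tower A B C g f by fact
  have mem: "(x \<otimes>\<^bsub>A\<^esub> \<gamma> y) \<odot>\<^bsub>AA\<^esub> u \<in> carrier AA"
    if "\<gamma> \<in> tower_End A B C g f" "u \<in> tower_tensor_centralizer A B C g f"
      "x \<in> carrier A" "y \<in> carrier A" for x y \<gamma> u
    using that tower_End_closed by (auto simp: tower_tensor_centralizer_def intro!: AA.lsmult_closed)
  {
    assume ?D
    then obtain N :: nat and h k where N: "N > 0"
      and h: "\<forall>i<N. h i \<in> bimodule_hom A C AA A_AC"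
      and k: "\<forall>i<N. k i \<in> bimodule_hom A C A_AC AA"
      and kh: "\<forall>t\<in>carrier AA. t = (\<Oplus>\<^bsub>AA\<^esub>i\<in>{..<N}. k i (h i t))"
      unfolding right_depth_three_iff_homs by (elim exE conjE)
    note h = h[rule_format] and k = k[rule_format]
    \<comment> \<open>Coordinates are numbered from \<open>0\<close>, the elements of the depth three identity from \<open>1\<close>.\<close>
    define \<gamma> where "\<gamma> i y = h (i - 1) (tens \<one>\<^bsub>A\<^esub> y)" for i y
    define u where "u i = k (i - 1) \<one>\<^bsub>A\<^esub>" for i
    have \<gamma>: "\<gamma> (Suc i) \<in> tower_End A B C g f" if "i < N" for i
      using hom_to_ring_imp_tower_End[OF h[OF that]] by (simp add: \<gamma>_def[abs_def])
    have u: "u (Suc i) \<in> tower_tensor_centralizer A B C g f" if "i < N" for i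
      using hom_from_ring_imp_centralizer(1)[OF k[OF that]] by (simp add: u_def)
    have "tens x y = (\<Oplus>\<^bsub>AA\<^esub>i\<in>{1..N}. (x \<otimes>\<^bsub>A\<^esub> \<gamma> i y) \<odot>\<^bsub>AA\<^esub> u i)"
      if xy: "x \<in> carrier A" "y \<in> carrier A" for x y
    proof -
      have m: "(x \<otimes>\<^bsub>A\<^esub> \<gamma> (Suc i) y) \<odot>\<^bsub>AA\<^esub> u (Suc i) \<in> carrier AA" if "i < N" for i
        using mem[OF \<gamma>[OF that] u[OF that] xy] .
      have "k i (h i (tens x y)) = (x \<otimes>\<^bsub>A\<^esub> \<gamma> (Suc i) y) \<odot>\<^bsub>AA\<^esub> u (Suc i)" if "i < N" for i
        using hom_to_ring_tens[OF h[OF that] xy] xy tower_End_closed[OF \<gamma>[OF that], of y]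
          hom_from_ring_imp_centralizer(2)[OF k[OF that], of "x \<otimes>\<^bsub>A\<^esub> \<gamma> (Suc i) y"]
        by (simp add: \<gamma>_def u_def)
      then have "(\<Oplus>\<^bsub>AA\<^esub>i\<in>{..<N}. k i (h i (tens x y)))
          = (\<Oplus>\<^bsub>AA\<^esub>i\<in>{..<N}. (x \<otimes>\<^bsub>A\<^esub> \<gamma> (Suc i) y) \<odot>\<^bsub>AA\<^esub> u (Suc i))"
        by (intro AA.M.finsum_cong') (simp_all add: m)
      also have "\<dots> = (\<Oplus>\<^bsub>AA\<^esub>i\<in>{1..N}. (x \<otimes>\<^bsub>A\<^esub> \<gamma> i y) \<odot>\<^bsub>AA\<^esub> u i)"
        using m by (rule sum_shift[symmetric])
      finally show ?thesis
        using kh tensor.pure_closed[of x y] xy by simp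
    qed
    moreover have "\<forall>i\<in>{1..N}. \<gamma> i \<in> tower_End A B C g f"
      "\<forall>i\<in>{1..N}. u i \<in> tower_tensor_centralizer A B C g f"
      using \<gamma> u unfolding image_Suc_lessThan[symmetric] by auto
    ultimately show ?Q
      using N by blast
  next
    assume ?Q
    then obtain N :: nat and \<gamma> u where N: "N > 0"
      and \<gamma>1: "\<forall>i\<in>{1..N}. \<gamma> i \<in> tower_End A B C g f"
      and u1: "\<forall>i\<in>{1..N}. u i \<in> tower_tensor_centralizer A B C g f"
      and eq: "\<forall>x\<in>carrier A. \<forall>y\<in>carrier A.
        tens x y = (\<Oplus>\<^bsub>AA\<^esub>i\<in>{1..N}. (x \<otimes>\<^bsub>A\<^esub> \<gamma> i y) \<odot>\<^bsub>AA\<^esub> u i)"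
      by (elim exE conjE)
    have \<gamma>: "\<gamma> (Suc i) \<in> tower_End A B C g f"
      and u: "u (Suc i) \<in> tower_tensor_centralizer A B C g f" if "i < N" for i
      using \<gamma>1 u1 that by simp_all
    have "\<exists>h. h \<in> bimodule_hom A C AA A_AC \<and>
        (\<forall>x\<in>carrier A. \<forall>y\<in>carrier A. h (tens x y) = x \<otimes>\<^bsub>A\<^esub> \<gamma> (Suc i) y)" if "i < N" for i
      using tower_End_imp_hom_to_ring[OF \<gamma>[OF that]] by metis
    then obtain h where h: "\<And>i. i < N \<Longrightarrow> h i \<in> bimodule_hom A C AA A_AC"
      and h_tens: "\<And>i x y. \<lbrakk>i < N; x \<in> carrier A; y \<in> carrier A\<rbrakk>
        \<Longrightarrow> h i (tens x y) = x \<otimes>\<^bsub>A\<^esub> \<gamma> (Suc i) y"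
      by metis
    define k where "k i a = a \<odot>\<^bsub>AA\<^esub> u (Suc i)" for i a
    have k: "k i \<in> bimodule_hom A C A_AC AA" if "i < N" for i
      using centralizer_imp_hom_from_ring[OF u[OF that]] by (simp add: k_def[abs_def])
    have "tens x y = (\<Oplus>\<^bsub>AA\<^esub>i\<in>{..<N}. k i (h i (tens x y)))"
      if xy: "x \<in> carrier A" "y \<in> carrier A" for x y
    proof -
      have m: "(x \<otimes>\<^bsub>A\<^esub> \<gamma> (Suc i) y) \<odot>\<^bsub>AA\<^esub> u (Suc i) \<in> carrier AA" if "i < N" for i
        using mem[OF \<gamma>[OF that] u[OF that] xy] .
      have "tens x y = (\<Oplus>\<^bsub>AA\<^esub>i\<in>{..<N}. (x \<otimes>\<^bsub>A\<^esub> \<gamma> (Suc i) y) \<odot>\<^bsub>AA\<^esub> u (Suc i))"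
        unfolding eq[rule_format, OF xy] using m by (rule sum_shift)
      also have "\<dots> = (\<Oplus>\<^bsub>AA\<^esub>i\<in>{..<N}. k i (h i (tens x y)))"
        using xy by (intro AA.M.finsum_cong') (simp_all add: k_def h_tens m)
      finally show ?thesis .
    qed
    then have "\<forall>t\<in>carrier AA. t = (\<Oplus>\<^bsub>AA\<^esub>i\<in>{..<N}. k i (h i t))"
      using sum_hom_eq_id_iff[of N h k, OF h k] by blast
    then show ?D
      unfolding right_depth_three_iff_homs using N h k by blast
  }
qed

end
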